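(* Let $\mathfrak m$ be an uncountable cardinal satisfying $\sup\{\mathfrak m^{\mathfrak n} : \mathfrak n<\mathfrak m\}=\mathfrak m$, and let $G$ be a topological subgroup of $\mathrm{Iso}(\mathbb U_{\mathfrak m})$ of density $<\mathfrak m$ having property $(OB)$, which is either metrizable or locally connected. Then $G$ is a SIN group.
   Context: For an infinite cardinal $\mathfrak m$ with $\sup\{\mathfrak m^{\mathfrak n}:\mathfrak n<\mathfrak m\}=\mathfrak m$, $\mathbb U_{\mathfrak m}$ denotes the Urysohn--Katětov space: the complete metric space of weight $\mathfrak m$, unique up to isometry (Katětov), which contains an isometric copy of every metric space of weight $\le\mathfrak m$ and is $<\mathfrak m$-homogeneous: every isometry between two metric subspaces of density $<\mathfrak m$ extends to a self-isometry of the whole space. It has the one-point extension property: call a $1$-Lipschitz function $f:Y\to\mathbb R$ on a metric space $Y$ a Katětov function if $d(x,y)\le f(x)+f(y)$ for all $x,y\in Y$; if $Y\subseteq\mathbb U_{\mathfrak m}$ has density $<\mathfrak m$ and $f$ is a Katětov function on $Y$, then there is $z\in\mathbb U_{\mathfrak m}$ with $d(z,y)=f(y)$ for all $y\in Y$. $\mathrm{Iso}(\mathbb U_{\mathfrak m})$ is the group of isometries of $\mathbb U_{\mathfrak m}$ with the topology of simple (pointwise) convergence; a neighbourhood basis at the identity consists of the sets $\{g : d(x_i,gx_i)<\varepsilon,\ i=1,\dots,n\}$ with $x_1,\dots,x_n\in\mathbb U_{\mathfrak m}$ and $\varepsilon>0$. The density of a topological space is the smallest cardinality of a dense subset. A topological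 group $G$ has property $(OB)$ if every continuous left-invariant pseudometric on $G$ is bounded; equivalently, every orbit of each continuous action of $G$ by isometries on a metric space is bounded. A topological group is SIN if it has a basis at the identity consisting of open conjugation-invariant neighbourhoods; equivalently, its left and right uniform structures coincide. *)

theory Defs
  imports "HOL-Analysis.Analysis" "HOL-Algebra.Bij"
begin

unbundle cardinal_syntax
no_notation elt_set_eq (infix \<open>=o\<close> 50)

text \<open>A cardinal is a relation \<open>r\<close> with \<^prop>\<open>card_order_on (Field r) r\<close>.  Cardinals may
  live on different types, and are therefore only compared by \<open>=o\<close>, \<open>\<le>o\<close> and \<open><o\<close>.\<close>

definition min_card :: "'a set set \<Rightarrow> 'a rel" where
  "min_card \<F> = (SOME r. \<exists>A\<in>\<F>. r = |A| \<and> (\<forall>B\<in>\<F>. |A| \<le>o |B| ))"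

definition dense_in :: "'a topology \<Rightarrow> 'a set \<Rightarrow> bool" where
  "dense_in X D \<longleftrightarrow> D \<subseteq> topspace X \<and> X closure_of D = topspace X"

definition base_of :: "'a topology \<Rightarrow> 'a set set \<Rightarrow> bool" where
  "base_of X \<B> \<longleftrightarrow> (\<forall>B\<in>\<B>. openin X B) \<and> (\<forall>W. openin X W \<longrightarrow> (\<exists>\<C>\<subseteq>\<B>. W = \<Union>\<C>))"

definition top_density :: "'a topology \<Rightarrow> 'a rel" where
  "top_density X = min_card {D. dense_in X D}"

definition weight :: "'a topology \<Rightarrow> 'a set rel" where
  "weight X = min_card {\<B>. base_of X \<B>}"

lemma min_card:
  assumes "A \<in> \<F>"
  shows "\<exists>A\<in>\<F>. min_card \<F> = |A| \<and> (\<forall>B\<in>\<F>. |A| \<le>o |B| )"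
proof -
  have "\<exists>r\<in>card_of ` \<F>. \<forall>r'\<in>card_of ` \<F>. r \<le>o r'"
  proof (rule exists_minim_Card_order)
    show "card_of ` \<F> \<noteq> {}" using assms by blast
    show "\<forall>r\<in>card_of ` \<F>. Card_order r" by (intro ballI) (elim imageE, simp only: card_of_Card_order)
  qed
  then obtain A where "A \<in> \<F>" "\<forall>B\<in>\<F>. |A| \<le>o |B|" by (auto simp only: bex_simps ball_simps)
  then have "\<exists>r. \<exists>A\<in>\<F>. r = |A| \<and> (\<forall>B\<in>\<F>. |A| \<le>o |B| )" by blast
  then show ?thesis unfolding min_card_def by (rule someI_ex)
qed

lemma dense_in_topspace: "dense_in X (topspace X)"
  by (simp add: dense_in_def)

lemma base_of_open: "base_of X {W. openin X W}"
proof -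
  have "\<exists>\<C>\<subseteq>{W. openin X W}. W = \<Union>\<C>" if "openin X W" for W
    using that by (intro exI[of _ "{W}"]) simp
  then show ?thesis by (simp add: base_of_def)
qed

lemma top_density_attained: "\<exists>D. dense_in X D \<and> top_density X = |D|"
  using min_card[of "topspace X" "{D. dense_in X D}"] dense_in_topspace
  unfolding top_density_def by blast

lemma top_density_le: "dense_in X D \<Longrightarrow> top_density X \<le>o |D|"
  using min_card[of D "{D. dense_in X D}"] unfolding top_density_def by force

lemma weight_attained: "\<exists>\<B>. base_of X \<B> \<and> weight X = |\<B>|"
  using min_card[of "{W. openin X W}" "{\<B>. base_of X \<B>}"] base_of_open
  unfolding weight_def by blast

lemma weight_le: "base_of X \<B> \<Longrightarrow> weight X \<le>o |\<B>|"
  using min_card[of \<B> "{\<B>. base_of X \<B>}"] unfolding weight_def by force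

text \<open>In the next definition it is enough to let the competing upper bound \<open>k'\<close> range over the
  cardinals on the type of \<open>k\<close>: every cardinal below \<open>k\<close> is equal to one of these.\<close>

definition is_card_sup :: "'a rel set \<Rightarrow> 'b rel \<Rightarrow> bool" where
  "is_card_sup S k \<longleftrightarrow> Card_order k \<and> (\<forall>r\<in>S. r \<le>o k) \<and>
     (\<forall>k' :: 'b rel. Card_order k' \<and> (\<forall>r\<in>S. r \<le>o k') \<longrightarrow> k \<le>o k')"

locale topological_group = group G for G (structure) +
  fixes T :: "'a topology"
  assumes topspace_eq: "topspace T = carrier G"
    and continuous_mult: "continuous_map (prod_topology T T) T (\<lambda>(x, y). x \<otimes> y)"
    and continuous_inv: "continuous_map T T (\<lambda>x. inv x)"

definition pseudometric_on :: "'a set \<Rightarrow> ('a \<Rightarrow> 'a \<Rightarrow> real) \<Rightarrow> bool" where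
  "pseudometric_on S p \<longleftrightarrow>
     (\<forall>x\<in>S. \<forall>y\<in>S. 0 \<le> p x y) \<and> (\<forall>x\<in>S. p x x = 0) \<and>
     (\<forall>x\<in>S. \<forall>y\<in>S. p x y = p y x) \<and>
     (\<forall>x\<in>S. \<forall>y\<in>S. \<forall>z\<in>S. p x z \<le> p x y + p y z)"

definition property_OB :: "('a, 'b) monoid_scheme \<Rightarrow> 'a topology \<Rightarrow> bool" where
  "property_OB G T \<longleftrightarrow> topological_group G T \<and>
     (\<forall>p. pseudometric_on (carrier G) p \<and>
          continuous_map (prod_topology T T) euclideanreal (\<lambda>(x, y). p x y) \<and>
          (\<forall>g\<in>carrier G. \<forall>x\<in>carrier G. \<forall>y\<in>carrier G.
             p (g \<otimes>\<^bsub>G\<^esub> x) (g \<otimes>\<^bsub>G\<^esub> y) = p x y)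
        \<longrightarrow> (\<exists>C. \<forall>x\<in>carrier G. \<forall>y\<in>carrier G. p x y \<le> C))"

definition SIN_group :: "('a, 'b) monoid_scheme \<Rightarrow> 'a topology \<Rightarrow> bool" where
  "SIN_group G T \<longleftrightarrow> topological_group G T \<and>
     (\<forall>W. openin T W \<and> \<one>\<^bsub>G\<^esub> \<in> W \<longrightarrow>
        (\<exists>V. openin T V \<and> \<one>\<^bsub>G\<^esub> \<in> V \<and> V \<subseteq> W \<and>
             (\<forall>g\<in>carrier G. (\<lambda>x. g \<otimes>\<^bsub>G\<^esub> x \<otimes>\<^bsub>G\<^esub> inv\<^bsub>G\<^esub> g) ` V = V)))"

definition isometric_on :: "'a metric \<Rightarrow> 'b metric \<Rightarrow> 'a set \<Rightarrow> ('a \<Rightarrow> 'b) \<Rightarrow> bool" where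
  "isometric_on N U A f \<longleftrightarrow> f ` A \<subseteq> mspace U \<and>
     (\<forall>x\<in>A. \<forall>y\<in>A. mdist U (f x) (f y) = mdist N x y)"

text \<open>As in \<^const>\<open>BijGroup\<close>, isometries are extensional functions, i.e. \<^term>\<open>undefined\<close> outside
  of the space.  This matches \<^const>\<open>product_topology\<close>, whose points are extensional as well.\<close>

definition Iso :: "'a metric \<Rightarrow> ('a \<Rightarrow> 'a) monoid" where
  "Iso U = (BijGroup (mspace U)) \<lparr>carrier := {g \<in> Bij (mspace U). isometric_on U U (mspace U) g}\<rparr>"

definition pointwise_topology :: "'a metric \<Rightarrow> ('a \<Rightarrow> 'a) set \<Rightarrow> ('a \<Rightarrow> 'a) topology" where
  "pointwise_topology U H = subtopology (product_topology (\<lambda>_. mtopology_of U) (mspace U)) H"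

lemma carrier_Iso: "carrier (Iso U) = {g \<in> Bij (mspace U). isometric_on U U (mspace U) g}"
  by (simp add: Iso_def)

lemma mult_Iso: "f \<in> carrier (Iso U) \<Longrightarrow> g \<in> carrier (Iso U) \<Longrightarrow> f \<otimes>\<^bsub>Iso U\<^esub> g = compose (mspace U) f g"
  by (simp add: Iso_def BijGroup_def)

lemma Iso_mem:
  assumes "f \<in> carrier (Iso U)"
  shows "f ` mspace U = mspace U" "x \<in> mspace U \<Longrightarrow> f x \<in> mspace U"
    "x \<in> mspace U \<Longrightarrow> y \<in> mspace U \<Longrightarrow> mdist U (f x) (f y) = mdist U x y"
    "f \<in> extensional (mspace U)" "inj_on f (mspace U)"
  using assms unfolding carrier_Iso isometric_on_def Bij_def bij_betw_def by auto

lemma subgroup_Iso: "subgroup (carrier (Iso U)) (BijGroup (mspace U))"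
proof (rule group.subgroupI[OF group_BijGroup])
  show "carrier (Iso U) \<subseteq> carrier (BijGroup (mspace U))"
    by (auto simp: carrier_Iso BijGroup_def)
  have "(\<lambda>x\<in>mspace U. x) \<in> carrier (Iso U)"
    by (auto simp: carrier_Iso id_Bij isometric_on_def)
  then show "carrier (Iso U) \<noteq> {}" by blast
next
  fix f assume f: "f \<in> carrier (Iso U)"
  then have fB: "f \<in> Bij (mspace U)" by (simp add: carrier_Iso)
  let ?i = "inv_into (mspace U) f"
  have i: "?i x \<in> mspace U" "f (?i x) = x" if "x \<in> mspace U" for x
    using that Iso_mem(1)[OF f] by (simp_all add: inv_into_into f_inv_into_f)
  have "mdist U (?i x) (?i y) = mdist U x y" if "x \<in> mspace U" "y \<in> mspace U" for x y
    using Iso_mem(3)[OF f i(1)[OF that(1)] i(1)[OF that(2)]] i(2) that by simp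
  then have "(\<lambda>x\<in>mspace U. ?i x) \<in> carrier (Iso U)"
    using i(1) restrict_inv_into_Bij[OF fB] by (auto simp: carrier_Iso isometric_on_def)
  then show "inv\<^bsub>BijGroup (mspace U)\<^esub> f \<in> carrier (Iso U)"
    by (simp add: inv_BijGroup[OF fB])
next
  fix f g assume fg: "f \<in> carrier (Iso U)" "g \<in> carrier (Iso U)"
  then have "f \<in> Bij (mspace U)" "g \<in> Bij (mspace U)" by (simp_all add: carrier_Iso)
  then show "f \<otimes>\<^bsub>BijGroup (mspace U)\<^esub> g \<in> carrier (Iso U)"
    using Iso_mem(2,3)[OF fg(1)] Iso_mem(2,3)[OF fg(2)]
    by (simp add: carrier_Iso BijGroup_def compose_Bij isometric_on_def compose_eq image_subset_iff)
qed

lemma group_Iso: "group (Iso U)"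
  using subgroup.subgroup_is_group[OF subgroup_Iso group_BijGroup, of U]
  by (simp add: Iso_def)

lemma inv_Iso:
  assumes f: "f \<in> carrier (Iso U)" and x: "x \<in> mspace U"
  shows "(inv\<^bsub>Iso U\<^esub> f) x \<in> mspace U" "f ((inv\<^bsub>Iso U\<^esub> f) x) = x"
proof -
  interpret group "Iso U" by (rule group_Iso)
  show "(inv\<^bsub>Iso U\<^esub> f) x \<in> mspace U" by (rule Iso_mem(2)[OF inv_closed[OF f] x])
  have "compose (mspace U) f (inv\<^bsub>Iso U\<^esub> f) = \<one>\<^bsub>Iso U\<^esub>"
    using mult_Iso[OF f inv_closed[OF f]] r_inv[OF f] by (rule trans[OF sym])
  then have "compose (mspace U) f (inv\<^bsub>Iso U\<^esub> f) x = x"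
    using x by (simp only:) (simp add: Iso_def BijGroup_def)
  then show "f ((inv\<^bsub>Iso U\<^esub> f) x) = x" using x by (simp add: compose_eq)
qed

lemma topspace_pointwise_topology:
  "H \<subseteq> carrier (Iso U) \<Longrightarrow> topspace (pointwise_topology U H) = H"
proof -
  assume H: "H \<subseteq> carrier (Iso U)"
  have "f \<in> (\<Pi>\<^sub>E x\<in>mspace U. mspace U)" if "f \<in> H" for f
    using Iso_mem(2,4)[OF subsetD[OF H that]] by (simp add: PiE_iff)
  then show ?thesis unfolding pointwise_topology_def by auto
qed

lemma openin_pointwise_topology:
  assumes H: "H \<subseteq> carrier (Iso U)" and x: "x \<in> mspace U" and y: "y \<in> mspace U"
  shows "openin (pointwise_topology U H) {f \<in> H. mdist U y (f x) < e}"
proof -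
  interpret Metric_space "mspace U" "mdist U" by simp
  have "continuous_map (pointwise_topology U H) (mtopology_of U) (\<lambda>f. f x)"
    unfolding pointwise_topology_def
    by (intro continuous_map_from_subtopology continuous_map_product_projection x)
  moreover have "openin (mtopology_of U) (mball y e)" by (simp add: mtopology_of_def)
  ultimately have "openin (pointwise_topology U H)
      {f \<in> topspace (pointwise_topology U H). f x \<in> mball y e}"
    by (rule openin_continuous_map_preimage)
  moreover have "{f \<in> topspace (pointwise_topology U H). f x \<in> mball y e} = {f \<in> H. mdist U y (f x) < e}"
    using H x y Iso_mem(2)[OF subsetD[OF H] x] by (auto simp: topspace_pointwise_topology)
  ultimately show ?thesis by simp
qed

lemma continuous_map_into_pointwise_topology:
  assumes H: "H \<subseteq> carrier (Iso U)" and F: "\<And>z. z \<in> topspace X \<Longrightarrow> F z \<in> H"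
    and loc: "\<And>z x e. z \<in> topspace X \<Longrightarrow> x \<in> mspace U \<Longrightarrow> 0 < e \<Longrightarrow>
      \<exists>V. openin X V \<and> z \<in> V \<and> (\<forall>w\<in>V. mdist U (F z x) (F w x) < e)"
  shows "continuous_map X (pointwise_topology U H) F"
proof -
  interpret Metric_space "mspace U" "mdist U" by simp
  have mem: "F z x \<in> mspace U" if "z \<in> topspace X" "x \<in> mspace U" for z x
    by (rule Iso_mem(2)[OF subsetD[OF H F[OF that(1)]] that(2)])
  have "continuous_map X (mtopology_of U) (\<lambda>z. F z x)" if x: "x \<in> mspace U" for x
    unfolding mtopology_of_def continuous_map_to_metric
  proof (intro ballI allI impI)
    fix z and e :: real assume z: "z \<in> topspace X" and e: "e > 0"
    obtain V where V: "openin X V" "z \<in> V" "\<forall>w\<in>V. mdist U (F z x) (F w x) < e"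
      using loc[OF z x e] by blast
    have "F w x \<in> mball (F z x) e" if "w \<in> V" for w
      using V(3) that mem[OF z x] mem[OF subsetD[OF openin_subset[OF V(1)] that] x] by simp
    with V show "\<exists>V. openin X V \<and> z \<in> V \<and> (\<forall>w\<in>V. F w x \<in> mball (F z x) e)" by blast
  qed
  moreover have "F ` topspace X \<subseteq> extensional (mspace U)" "F ` topspace X \<subseteq> H"
    using F Iso_mem(4)[OF subsetD[OF H F]] by auto
  ultimately show ?thesis
    by (simp add: pointwise_topology_def continuous_map_in_subtopology continuous_map_componentwise image_subset_iff_funcset)
qed

lemma topological_group_Iso:
  assumes sub: "subgroup H (Iso U)"
  shows "topological_group (Iso U\<lparr>carrier := H\<rparr>) (pointwise_topology U H)"
proof -
  interpret group "Iso U" by (rule group_Iso)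
  interpret H: subgroup H "Iso U" by (rule sub)
  let ?T = "pointwise_topology U H"
  have H: "H \<subseteq> carrier (Iso U)" by (rule H.subset)
  note [simp] = topspace_pointwise_topology[OF H]
  have HI: "f \<in> carrier (Iso U)" if "f \<in> H" for f using that H by blast
  have "continuous_map (prod_topology ?T ?T) ?T (\<lambda>(f, g). f \<otimes>\<^bsub>Iso U\<^esub> g)"
  proof (rule continuous_map_into_pointwise_topology[OF H])
    show "(case z of (f, g) \<Rightarrow> f \<otimes>\<^bsub>Iso U\<^esub> g) \<in> H" if "z \<in> topspace (prod_topology ?T ?T)" for z
      using that by auto
    fix z x and e :: real
    assume z: "z \<in> topspace (prod_topology ?T ?T)" and x: "x \<in> mspace U" and e: "0 < e"
    obtain f g where fg: "z = (f, g)" "f \<in> H" "g \<in> H" using z by auto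
    note f = Iso_mem[OF HI[OF fg(2)]] and g = Iso_mem[OF HI[OF fg(3)]]
    define V where "V = {k \<in> H. mdist U (f (g x)) (k (g x)) < e / 2} \<times> {k \<in> H. mdist U (g x) (k x) < e / 2}"
    have "openin (prod_topology ?T ?T) V"
      unfolding V_def openin_prod_Times_iff
      using openin_pointwise_topology[OF H] x f(2) g(2) by blast
    moreover have "z \<in> V"
      using fg e mdist_zero[OF f(2)[OF g(2)[OF x]] f(2)[OF g(2)[OF x]]] mdist_zero[OF g(2)[OF x] g(2)[OF x]]
      by (simp add: V_def)
    moreover have "mdist U ((f \<otimes>\<^bsub>Iso U\<^esub> g) x) ((f' \<otimes>\<^bsub>Iso U\<^esub> g') x) < e" if "(f', g') \<in> V" for f' g'
    proof -
      have H': "f' \<in> H" "g' \<in> H" and d: "mdist U (f (g x)) (f' (g x)) < e / 2" "mdist U (g x) (g' x) < e / 2"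
        using that by (auto simp: V_def)
      note f' = Iso_mem[OF HI[OF H'(1)]] and g' = Iso_mem[OF HI[OF H'(2)]]
      have "mdist U (f (g x)) (f' (g' x)) \<le> mdist U (f (g x)) (f' (g x)) + mdist U (f' (g x)) (f' (g' x))"
        by (intro mdist_triangle) (use x f(2) g(2) f'(2) g'(2) in auto)
      also have "mdist U (f' (g x)) (f' (g' x)) = mdist U (g x) (g' x)"
        using f'(3) g(2) g'(2) x by blast
      finally have "mdist U (f (g x)) (f' (g' x)) < e" using d by linarith
      then show ?thesis using x fg H' HI by (simp add: mult_Iso compose_eq)
    qed
    ultimately show "\<exists>V. openin (prod_topology ?T ?T) V \<and> z \<in> V \<and>
        (\<forall>w\<in>V. mdist U ((case z of (f, g) \<Rightarrow> f \<otimes>\<^bsub>Iso U\<^esub> g) x) ((case w of (f, g) \<Rightarrow> f \<otimes>\<^bsub>Iso U\<^esub> g) x) < e)"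
      using fg(1) by (intro exI[of _ V]) auto
  qed
  moreover have "continuous_map ?T ?T (\<lambda>f. inv\<^bsub>Iso U\<^esub> f)"
  proof (rule continuous_map_into_pointwise_topology[OF H])
    show "inv\<^bsub>Iso U\<^esub> f \<in> H" if "f \<in> topspace ?T" for f using that by auto
    fix f x and e :: real
    assume "f \<in> topspace ?T" and x: "x \<in> mspace U" and e: "0 < e"
    then have fH: "f \<in> H" by simp
    define y where "y = (inv\<^bsub>Iso U\<^esub> f) x"
    have y: "y \<in> mspace U" "f y = x" using inv_Iso[OF HI[OF fH] x] by (simp_all add: y_def)
    define V where "V = {k \<in> H. mdist U x (k y) < e}"
    have "openin ?T V" unfolding V_def by (rule openin_pointwise_topology[OF H y(1) x])
    moreover have "f \<in> V" using fH y e mdist_zero[OF x x] by (simp add: V_def)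
    moreover have "mdist U y ((inv\<^bsub>Iso U\<^esub> k) x) < e" if "k \<in> V" for k
    proof -
      have k: "k \<in> carrier (Iso U)" "mdist U x (k y) < e" using that HI by (auto simp: V_def)
      have "mdist U y ((inv\<^bsub>Iso U\<^esub> k) x) = mdist U (k y) (k ((inv\<^bsub>Iso U\<^esub> k) x))"
        using Iso_mem(3)[OF k(1) y(1) inv_Iso(1)[OF k(1) x]] by simp
      then show ?thesis using k(2) inv_Iso(2)[OF k(1) x] by (simp add: mdist_commute)
    qed
    ultimately show "\<exists>V. openin ?T V \<and> f \<in> V \<and> (\<forall>k\<in>V. mdist U ((inv\<^bsub>Iso U\<^esub> f) x) ((inv\<^bsub>Iso U\<^esub> k) x) < e)"
      unfolding y_def by blast
  qed
  then have "continuous_map ?T ?T (\<lambda>f. inv\<^bsub>Iso U\<lparr>carrier := H\<rparr>\<^esub> f)"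
    by (rule continuous_map_eq) (simp add: m_inv_consistent[OF sub])
  ultimately show ?thesis
    using subgroup.subgroup_is_group[OF sub group_Iso]
    unfolding topological_group_def topological_group_axioms_def by simp
qed

text \<open>Universality is stated for the metric spaces on the type of \<open>U\<close>.  For uncountable \<open>m\<close> as
  below this is no restriction: a metric space of weight at most \<open>m\<close> has at most
  \<open>m ^c natLeq = m\<close> points, and so has an isometric copy on this type; see
  \<open>Urysohn_Katetov_universal\<close>.\<close>

definition Urysohn_Katetov :: "'m rel \<Rightarrow> 'a metric \<Rightarrow> bool" where
  "Urysohn_Katetov m U \<longleftrightarrow>
     mcomplete_of U \<and> weight (mtopology_of U) =o m \<and>
     (\<forall>N :: 'a metric. weight (mtopology_of N) \<le>o m \<longrightarrow> (\<exists>f. isometric_on N U (mspace N) f)) \<and>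
     (\<forall>A B f. A \<subseteq> mspace U \<and> B \<subseteq> mspace U \<and>
        top_density (subtopology (mtopology_of U) A) <o m \<and>
        top_density (subtopology (mtopology_of U) B) <o m \<and>
        isometric_on U U A f \<and> f ` A = B \<longrightarrow>
        (\<exists>g\<in>carrier (Iso U). \<forall>x\<in>A. g x = f x))"

lemma openin_mtopology_of:
  "openin (mtopology_of U) W \<longleftrightarrow>
     W \<subseteq> mspace U \<and> (\<forall>x\<in>W. \<exists>r>0. \<forall>y\<in>mspace U. mdist U x y < r \<longrightarrow> y \<in> W)"
proof -
  interpret Metric_space "mspace U" "mdist U" by simp
  have "mball x r \<subseteq> W \<longleftrightarrow> (\<forall>y\<in>mspace U. mdist U x y < r \<longrightarrow> y \<in> W)" if "x \<in> mspace U" for x r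
    using that by (auto simp: subset_iff)
  then show ?thesis
    unfolding mtopology_of_def openin_mtopology by (meson subsetD)
qed

lemma base_of_mtopology:
  assumes "\<And>B. B \<in> \<B> \<Longrightarrow> openin (mtopology_of U) B"
    and "\<And>x r. x \<in> mspace U \<Longrightarrow> 0 < r \<Longrightarrow> \<exists>B\<in>\<B>. x \<in> B \<and> (\<forall>y\<in>B. mdist U x y < r)"
  shows "base_of (mtopology_of U) \<B>"
  unfolding base_of_def
proof (intro conjI ballI allI impI)
  fix W assume W: "openin (mtopology_of U) W"
  have "\<exists>B\<in>\<B>. x \<in> B \<and> B \<subseteq> W" if x: "x \<in> W" for x
  proof -
    from W x obtain r where r: "r > 0" "\<forall>y\<in>mspace U. mdist U x y < r \<longrightarrow> y \<in> W"
      and xU: "x \<in> mspace U"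
      unfolding openin_mtopology_of by blast
    from assms(2)[OF xU r(1)] obtain B where B: "B \<in> \<B>" "x \<in> B" "\<forall>y\<in>B. mdist U x y < r"
      by blast
    have "B \<subseteq> mspace U" using assms(1)[OF B(1)] unfolding openin_mtopology_of by blast
    with B r show ?thesis by blast
  qed
  then have "W = \<Union>{B\<in>\<B>. B \<subseteq> W}" by blast
  then show "\<exists>\<C>\<subseteq>\<B>. W = \<Union>\<C>" by (intro exI[of _ "{B\<in>\<B>. B \<subseteq> W}"]) auto
qed (use assms(1) in auto)

lemma base_of_mtopologyD:
  assumes "base_of (mtopology_of U) \<B>" "x \<in> mspace U" "0 < r"
  shows "\<exists>B\<in>\<B>. x \<in> B \<and> (\<forall>y\<in>B. mdist U x y < r)"
proof -
  interpret Metric_space "mspace U" "mdist U" by simp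
  have "openin (mtopology_of U) (mball x r)" by (simp add: mtopology_of_def)
  then obtain \<C> where "\<C> \<subseteq> \<B>" "mball x r = \<Union>\<C>"
    using assms(1) unfolding base_of_def by metis
  moreover have "x \<in> mball x r" using assms by simp
  ultimately show ?thesis by (metis Union_iff in_mball subsetD)
qed

lemma Urysohn_Katetov_universal:
  fixes m :: "'m rel" and U :: "'a metric" and N :: "'b metric"
  assumes m: "Card_order m" "natLeq <o m"
    and sup: "is_card_sup {m ^c n | n :: 'm rel. Card_order n \<and> n <o m} m"
    and U: "Urysohn_Katetov m U"
    and N: "weight (mtopology_of N) \<le>o m"
  shows "\<exists>f. isometric_on N U (mspace N) f"
proof -
  have exp: "m ^c natLeq \<le>o m"
  proof -
    have "|UNIV :: nat set| <o m"
      using m(2) card_of_nat by (rule ordIso_ordLess_trans[rotated])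
    then obtain S where S: "|UNIV :: nat set| =o |S :: 'm set|" "|S| <o m"
      using internalize_card_of_ordLess[of "UNIV :: nat set" m] by auto
    have "m ^c |S| \<le>o m"
      using sup S(2) card_of_Card_order[of S] unfolding is_card_sup_def by auto
    moreover have "m ^c natLeq =o m ^c |S|"
      by (rule cexp_cong2[OF ordIso_transitive[OF ordIso_symmetric[OF card_of_nat] S(1)]
            m(1) natLeq_Card_order])
    ultimately show ?thesis using ordIso_ordLeq_trans by auto
  qed
  have cardN: "|mspace N| \<le>o m"
  proof -
    obtain \<B> where \<B>: "base_of (mtopology_of N) \<B>" "weight (mtopology_of N) = |\<B>|"
      using weight_attained[of "mtopology_of N"] by auto
    define b where "b x n = (SOME B. B \<in> \<B> \<and> x \<in> B \<and> (\<forall>y\<in>B. mdist N x y < 1 / Suc n))"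
      for x and n :: nat
    have b: "b x n \<in> \<B> \<and> x \<in> b x n \<and> (\<forall>y\<in>b x n. mdist N x y < 1 / Suc n)"
      if "x \<in> mspace N" for x n
    proof -
      have "\<exists>B. B \<in> \<B> \<and> x \<in> B \<and> (\<forall>y\<in>B. mdist N x y < 1 / Suc n)"
        using base_of_mtopologyD[OF \<B>(1) that, of "1 / Suc n"] by auto
      then show ?thesis unfolding b_def by (rule someI_ex)
    qed
    have "inj_on b (mspace N)"
    proof (rule inj_onI, rule ccontr)
      fix x y assume xy: "x \<in> mspace N" "y \<in> mspace N" "b x = b y" "x \<noteq> y"
      then have "mdist N x y > 0" by (metis less_eq_real_def mdist_nonneg mdist_zero)
      then obtain n where "1 / Suc n < mdist N x y"
        using nat_approx_posE by blast
      with b[OF xy(1), of n] b[OF xy(2), of n] xy(3) show False by fastforce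
    qed
    moreover have "b ` mspace N \<subseteq> Func UNIV \<B>" using b unfolding Func_def by auto
    ultimately have "|mspace N| \<le>o |Func (UNIV :: nat set) \<B>|"
      using card_of_ordLeq by blast
    also have "|Func (UNIV :: nat set) \<B>| = |\<B>| ^c natLeq"
      by (simp add: cexp_def Field_card_of Field_natLeq)
    also have "|\<B>| ^c natLeq \<le>o m ^c natLeq"
      by (rule cexp_mono1) (use N \<B> natLeq_Card_order in auto)
    finally show ?thesis using exp by (blast intro: ordLeq_transitive)
  qed
  have cardU: "m \<le>o |mspace U|"
  proof -
    interpret UU: Metric_space "mspace U" "mdist U" by simp
    define ball where "ball p = UU.mball (fst p) (1 / Suc (snd p))" for p :: "'a \<times> nat"
    have "base_of (mtopology_of U) (ball ` (mspace U \<times> UNIV))"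
    proof (rule base_of_mtopology)
      show "openin (mtopology_of U) B" if "B \<in> ball ` (mspace U \<times> UNIV)" for B
        using that unfolding ball_def mtopology_of_def by auto
      fix x and r :: real assume x: "x \<in> mspace U" "0 < r"
      then obtain n where "1 / Suc n < r" using nat_approx_posE by blast
      with x have "x \<in> ball (x, n) \<and> (\<forall>y\<in>ball (x, n). mdist U x y < r)"
        by (auto simp: ball_def)
      moreover have "ball (x, n) \<in> ball ` (mspace U \<times> UNIV)" using x by blast
      ultimately show "\<exists>B\<in>ball ` (mspace U \<times> UNIV). x \<in> B \<and> (\<forall>y\<in>B. mdist U x y < r)"
        by blast
    qed
    then have "weight (mtopology_of U) \<le>o |ball ` (mspace U \<times> UNIV)|" by (rule weight_le)
    moreover have "m =o weight (mtopology_of U)"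
      using U unfolding Urysohn_Katetov_def by (blast intro: ordIso_symmetric)
    ultimately have mle: "m \<le>o |mspace U \<times> (UNIV :: nat set)|"
      by (meson card_of_image ordIso_ordLeq_trans ordLeq_transitive)
    have inf: "infinite (mspace U)"
    proof
      assume "finite (mspace U)"
      then have "countable (mspace U \<times> (UNIV :: nat set))" by (simp add: countable_finite)
      then obtain h :: "'a \<times> nat \<Rightarrow> nat" where "inj_on h (mspace U \<times> UNIV)"
        unfolding countable_def by blast
      then have "|mspace U \<times> (UNIV :: nat set)| \<le>o |UNIV :: nat set|"
        using card_of_ordLeq by blast
      with mle have "m \<le>o natLeq"
        by (meson card_of_nat ordLeq_ordIso_trans ordLeq_transitive)
      with m(2) show False using not_ordLess_ordLeq by blast
    qed
    then have "|UNIV :: nat set| \<le>o |mspace U|"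
      using infinite_iff_card_of_nat by blast
    then have "|mspace U \<times> (UNIV :: nat set)| =o |mspace U|"
      using card_of_Times_infinite[OF inf, of "UNIV :: nat set"] by blast
    with mle show ?thesis by (rule ordLeq_ordIso_trans)
  qed
  obtain h where h: "inj_on h (mspace N)" "h ` mspace N \<subseteq> mspace U"
    using ordLeq_transitive[OF cardN cardU] unfolding card_of_ordLeq[symmetric] by blast
  define k where "k = inv_into (mspace N) h"
  have k: "k (h x) = x" if "x \<in> mspace N" for x
    using h(1) that by (simp add: k_def)
  define N' where "N' = metric (h ` mspace N, \<lambda>x y. mdist N (k x) (k y))"
  have M': "Metric_space (h ` mspace N) (\<lambda>x y. mdist N (k x) (k y))"
    by unfold_locales (auto simp: k mdist_commute intro: mdist_triangle)
  have [simp]: "mspace N' = h ` mspace N" "mdist N' x y = mdist N (k x) (k y)" for x y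
    using M' by (simp_all add: N'_def Metric_space.mspace_metric Metric_space.mdist_metric)
  have "weight (mtopology_of N') \<le>o m"
  proof -
    obtain \<B> where \<B>: "base_of (mtopology_of N) \<B>" "weight (mtopology_of N) = |\<B>|"
      using weight_attained[of "mtopology_of N"] by auto
    have sub: "openin (mtopology_of N) B" if "B \<in> \<B>" for B
      using \<B>(1) that unfolding base_of_def by blast
    have "base_of (mtopology_of N') ((`) h ` \<B>)"
    proof (rule base_of_mtopology)
      show "openin (mtopology_of N') B'" if B': "B' \<in> (`) h ` \<B>" for B'
      proof -
        obtain B where B: "B \<in> \<B>" "B' = h ` B" using B' by blast
        have *: "B \<subseteq> mspace N" "\<forall>x\<in>B. \<exists>r>0. \<forall>y\<in>mspace N. mdist N x y < r \<longrightarrow> y \<in> B"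
          using sub[OF B(1)] unfolding openin_mtopology_of by blast+
        show ?thesis
          unfolding openin_mtopology_of B(2)
        proof (intro conjI ballI)
          show "h ` B \<subseteq> mspace N'" using * by auto
          fix z assume "z \<in> h ` B"
          then obtain x where x: "x \<in> B" "z = h x" by blast
          with * obtain r where "r > 0" "\<forall>y\<in>mspace N. mdist N x y < r \<longrightarrow> y \<in> B" by blast
          moreover have "x \<in> mspace N" using x * by blast
          ultimately show "\<exists>r>0. \<forall>y\<in>mspace N'. mdist N' z y < r \<longrightarrow> y \<in> h ` B"
            using x by (intro exI[of _ r]) (auto simp: k)
        qed
      qed
      fix z and r :: real assume "z \<in> mspace N'" "0 < r"
      then obtain x where x: "x \<in> mspace N" "z = h x" by auto
      from base_of_mtopologyD[OF \<B>(1) x(1) \<open>0 < r\<close>] obtain B where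
        B: "B \<in> \<B>" "x \<in> B" "\<forall>y\<in>B. mdist N x y < r" by blast
      have BN: "B \<subseteq> mspace N" using sub[OF B(1)] unfolding openin_mtopology_of by blast
      have "mdist N' z y < r" if "y \<in> h ` B" for y
      proof -
        obtain b where "b \<in> B" "y = h b" using \<open>y \<in> h ` B\<close> by blast
        then show ?thesis using B(3) BN x k by (simp add: subset_iff)
      qed
      then show "\<exists>B\<in>(`) h ` \<B>. z \<in> B \<and> (\<forall>y\<in>B. mdist N' z y < r)"
        using B(1,2) x(2) by blast
    qed
    then have "weight (mtopology_of N') \<le>o |(`) h ` \<B>|" by (rule weight_le)
    also have "|(`) h ` \<B>| \<le>o |\<B>|" by (rule card_of_image)
    also have "|\<B>| \<le>o m" using N \<B>(2) by simp
    finally show ?thesis .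
  qed
  then obtain f where f: "isometric_on N' U (mspace N') f"
    using U unfolding Urysohn_Katetov_def by blast
  have "isometric_on N U (mspace N) (f \<circ> h)"
    using f unfolding isometric_on_def by (auto simp: k)
  then show ?thesis by blast
qed

end

theory Submission
  imports Defs "HOL-Library.Ramsey"
begin

text \<open>Let \<open>Y\<close> be an orbit of \<open>H\<close>.  It is bounded by property (OB) and has density below \<open>m\<close>, so
  for \<open>A \<subseteq> Y\<close> and a large constant \<open>C\<close> the Katetov function \<open>C + d(\<cdot>, A)\<close> on \<open>Y\<close> is the distance
  to some point \<open>z\<close>.  Hence an element of \<open>H\<close> which moves \<open>z\<close> by less than \<open>e\<close> changes \<open>d(\<cdot>, A)\<close>
  by less than \<open>e\<close>, uniformly on \<open>Y\<close>.  The group is SIN if and only if small elements move all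
  points of each orbit uniformly little.  If this fails and \<open>H\<close> is metrizable, take bad elements
  \<open>w n\<close> tending to the identity and points \<open>y n\<close>; after passing to a subsequence by Ramsey's
  theorem, all the \<open>w n (y n)\<close> are far from \<open>A = {y k | k}\<close>, a contradiction.  If \<open>H\<close> is locally
  connected, take for \<open>A\<close> a maximal separated subset of \<open>Y\<close>: the elements of a connected
  neighbourhood cannot move a point of \<open>A\<close> to the vicinity of another one, hence they move all
  points of \<open>A\<close>, and so all points of \<open>Y\<close>, only a little.\<close>

subsection \<open>Density and weight\<close>

text \<open>Applied to evaluation maps, to bound the density of an orbit, and to isometries, to
  bound the density of a copy of a subspace.\<close>

lemma top_density_image_le:
  assumes f: "continuous_map X Y f" and surj: "f ` topspace X = topspace Y"
  shows "top_density Y \<le>o top_density X"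
proof -
  obtain D where D: "dense_in X D" "top_density X = |D|"
    using top_density_attained by blast
  then have DX: "D \<subseteq> topspace X" "X closure_of D = topspace X"
    by (simp_all add: dense_in_def)
  have "topspace Y \<subseteq> Y closure_of (f ` D)"
    using continuous_map_image_closure_subset[OF f, of D] DX(2) surj by simp
  then have "dense_in Y (f ` D)"
    using DX(1) surj closure_of_subset_topspace[of Y "f ` D"] by (auto simp: dense_in_def)
  then have "top_density Y \<le>o |f ` D|" by (rule top_density_le)
  also have "|f ` D| \<le>o |D|" by (rule card_of_image)
  finally show ?thesis using D(2) by simp
qed

lemma dense_in_mtopology_of:
  "dense_in (mtopology_of U) D \<longleftrightarrow>
     D \<subseteq> mspace U \<and> (\<forall>x\<in>mspace U. \<forall>r>0. \<exists>y\<in>D. mdist U x y < r)"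
proof -
  interpret Metric_space "mspace U" "mdist U" by simp
  have "mtopology_of U closure_of D = {x \<in> mspace U. \<forall>r>0. \<exists>y\<in>D. y \<in> mball x r}"
    by (simp only: mtopology_of_def metric_closure_of)
  then show ?thesis unfolding dense_in_def by (auto simp: set_eq_iff subset_iff; blast)
qed

text \<open>The balls of radius \<open>1 / Suc n\<close> around the points of \<open>D\<close> form
  a base.\<close>

lemma weight_mtopology_of_le:
  assumes D: "dense_in (mtopology_of U) D"
  shows "weight (mtopology_of U) \<le>o |D \<times> (UNIV :: nat set)|"
proof -
  interpret Metric_space "mspace U" "mdist U" by simp
  define ball where "ball p = mball (fst p) (1 / Suc (snd p))" for p :: "'a \<times> nat"
  have "base_of (mtopology_of U) (ball ` (D \<times> UNIV))"
  proof (rule base_of_mtopology)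
    show "openin (mtopology_of U) B" if "B \<in> ball ` (D \<times> UNIV)" for B
      using that unfolding ball_def mtopology_of_def by auto
    fix x and r :: real assume x: "x \<in> mspace U" "0 < r"
    \<comment> \<open>The balls are centred at points of \<open>D\<close> and not at
      \<open>x\<close>, so the radius is halved: a ball around \<open>y\<close> that contains
      \<open>x\<close> has its points within two radii of \<open>x\<close>.\<close>
    then obtain n where n: "1 / Suc n < r / 2" using nat_approx_posE[of "r / 2"] by auto
    obtain y where y: "y \<in> D" "mdist U x y < 1 / Suc n" "y \<in> mspace U"
      using D x unfolding dense_in_mtopology_of
      by (metis of_nat_0_less_iff subsetD zero_less_Suc zero_less_divide_1_iff)
    have "mdist U x z < r" if z: "z \<in> ball (y, n)" for z
      using z mdist_triangle[of x U y z] x y n by (simp add: ball_def)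
    moreover have "x \<in> ball (y, n)" using x y by (simp add: ball_def mdist_commute)
    ultimately show "\<exists>B\<in>ball ` (D \<times> UNIV). x \<in> B \<and> (\<forall>z\<in>B. mdist U x z < r)"
      using y(1) by blast
  qed
  then have "weight (mtopology_of U) \<le>o |ball ` (D \<times> UNIV)|" by (rule weight_le)
  also have "|ball ` (D \<times> UNIV)| \<le>o |D \<times> (UNIV :: nat set)|" by (rule card_of_image)
  finally show ?thesis .
qed

lemma isometric_on_imp_continuous_map:
  assumes f: "isometric_on N U A f" and A: "A \<subseteq> mspace N"
  shows "continuous_map (subtopology (mtopology_of N) A) (subtopology (mtopology_of U) (f ` A)) f"
proof -
  interpret N: Metric_space "mspace N" "mdist N" by simp
  interpret U: Metric_space "mspace U" "mdist U" by simp
  have "continuous_map (subtopology (mtopology_of N) A) U.mtopology f"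
    unfolding U.continuous_map_to_metric
  proof (intro ballI allI impI)
    fix x and e :: real
    assume "x \<in> topspace (subtopology (mtopology_of N) A)" and e: "0 < e"
    then have x: "x \<in> A" "x \<in> mspace N" by auto
    have "openin (mtopology_of N) (N.mball x e)" by (simp add: mtopology_of_def)
    then have "openin (subtopology (mtopology_of N) A) (N.mball x e \<inter> A)"
      by (auto simp: openin_subtopology)
    moreover have "x \<in> N.mball x e \<inter> A" using x e by simp
    moreover have "\<forall>y\<in>N.mball x e \<inter> A. f y \<in> U.mball (f x) e"
      using f x by (auto simp: isometric_on_def)
    ultimately show "\<exists>V. openin (subtopology (mtopology_of N) A) V \<and> x \<in> V \<and>
        (\<forall>y\<in>V. f y \<in> U.mball (f x) e)" by blast
  qed
  then show ?thesis
    by (auto simp: continuous_map_in_subtopology mtopology_of_def)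
qed

subsection \<open>One-point extensions\<close>

text \<open>\<open>None\<close> is the added point and \<open>f\<close> gives its distances to
  \<open>Y\<close>. The absolute values serve \<open>Metric_space\<close>, which asks for
  nonnegativity at all arguments, while \<open>f\<close> will be assumed positive on
  \<open>Y\<close> only.\<close>

definition one_point_extension :: "'a metric \<Rightarrow> 'a set \<Rightarrow> ('a \<Rightarrow> real) \<Rightarrow> 'a option metric" where
  "one_point_extension U Y f = metric (insert None (Some ` Y),
     \<lambda>p q. case p of
        None \<Rightarrow> (case q of None \<Rightarrow> 0 | Some y \<Rightarrow> \<bar>f y\<bar>)
      | Some x \<Rightarrow> (case q of None \<Rightarrow> \<bar>f x\<bar> | Some y \<Rightarrow> mdist U x y))"

text \<open>In the triangle inequality, \<open>lip\<close> is the case of \<open>None\<close> at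
  exactly one end and \<open>kat\<close> that of \<open>None\<close> in the middle. Strict
  positivity separates \<open>None\<close> from the points of \<open>Y\<close>.\<close>

lemma one_point_extension:
  assumes Y: "Y \<subseteq> mspace U" and pos: "\<And>y. y \<in> Y \<Longrightarrow> 0 < f y"
    and lip: "\<And>x y. x \<in> Y \<Longrightarrow> y \<in> Y \<Longrightarrow> f x \<le> mdist U x y + f y"
    and kat: "\<And>x y. x \<in> Y \<Longrightarrow> y \<in> Y \<Longrightarrow> mdist U x y \<le> f x + f y"
  shows mspace_one_point_extension: "mspace (one_point_extension U Y f) = insert None (Some ` Y)"
    and mdist_one_point_extension:
      "mdist (one_point_extension U Y f) None None = 0"
      "y \<in> Y \<Longrightarrow> mdist (one_point_extension U Y f) None (Some y) = f y"
      "x \<in> Y \<Longrightarrow> mdist (one_point_extension U Y f) (Some x) None = f x"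
      "mdist (one_point_extension U Y f) (Some x) (Some y) = mdist U x y"
proof -
  let ?d = "\<lambda>p q. case p of
        None \<Rightarrow> (case q of None \<Rightarrow> 0 | Some y \<Rightarrow> \<bar>f y\<bar>)
      | Some x \<Rightarrow> (case q of None \<Rightarrow> \<bar>f x\<bar> | Some y \<Rightarrow> mdist U x y)"
  let ?M = "insert None (Some ` Y)"
  have lip': "f y \<le> f x + mdist U x y" if "x \<in> Y" "y \<in> Y" for x y
    using lip[OF that(2,1)] by (simp add: mdist_commute)
  have "Metric_space ?M ?d"
  proof
    show "0 \<le> ?d p q" for p q by (simp split: option.split)
    show "?d p q = ?d q p" for p q by (simp add: mdist_commute split: option.split)
    show "?d p q = 0 \<longleftrightarrow> p = q" if "p \<in> ?M" "q \<in> ?M" for p q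
      using that Y pos[of "the p"] pos[of "the q"] mdist_zero[of "the p" U "the q"]
      by (cases p; cases q) (auto simp: subset_iff)
    show "?d p r \<le> ?d p q + ?d q r" if "p \<in> ?M" "q \<in> ?M" "r \<in> ?M" for p q r
    proof -
      have "mdist U x z \<le> mdist U x y + mdist U y z" if "x \<in> Y" "y \<in> Y" "z \<in> Y" for x y z
        by (rule mdist_triangle) (use that Y in auto)
      note facts = this[of "the p" "the q" "the r"] pos[of "the p"] pos[of "the q"] pos[of "the r"]
        lip[of "the p" "the q"] lip'[of "the q" "the r"] kat[of "the p" "the r"]
      show ?thesis
        using that facts by (cases p; cases q; cases r) auto
    qed
  qed
  note * = Metric_space.mspace_metric[OF this] Metric_space.mdist_metric[OF this]
  show "mspace (one_point_extension U Y f) = insert None (Some ` Y)"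
    "mdist (one_point_extension U Y f) None None = 0"
    "y \<in> Y \<Longrightarrow> mdist (one_point_extension U Y f) None (Some y) = f y"
    "x \<in> Y \<Longrightarrow> mdist (one_point_extension U Y f) (Some x) None = f x"
    "mdist (one_point_extension U Y f) (Some x) (Some y) = mdist U x y"
    using pos[of x] pos[of y] by (simp_all add: one_point_extension_def *)
qed

text \<open>Universality embeds \<open>Y\<close> together with a new point that realises
  \<open>f\<close>; homogeneity carries the embedded copy of \<open>Y\<close> back onto
  \<open>Y\<close>, and the image of the new point is \<open>z\<close>.\<close>

lemma Urysohn_Katetov_one_point_extension:
  fixes m :: "'m rel" and U :: "'a metric"
  assumes m: "Card_order m" "natLeq <o m"
    and sup: "is_card_sup {m ^c n | n :: 'm rel. Card_order n \<and> n <o m} m"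
    and U: "Urysohn_Katetov m U"
    and Y: "Y \<subseteq> mspace U" and dens: "top_density (subtopology (mtopology_of U) Y) <o m"
    and pos: "\<And>y. y \<in> Y \<Longrightarrow> 0 < f y"
    and lip: "\<And>x y. x \<in> Y \<Longrightarrow> y \<in> Y \<Longrightarrow> f x \<le> mdist U x y + f y"
    and kat: "\<And>x y. x \<in> Y \<Longrightarrow> y \<in> Y \<Longrightarrow> mdist U x y \<le> f x + f y"
  obtains z where "z \<in> mspace U" "\<And>y. y \<in> Y \<Longrightarrow> mdist U z y = f y"
proof -
  define N where "N = one_point_extension U Y f"
  have mspN: "mspace N = insert None (Some ` Y)"
    unfolding N_def using pos lip kat by (rule mspace_one_point_extension[OF Y])
  have mdN: "mdist N None None = 0" "y \<in> Y \<Longrightarrow> mdist N None (Some y) = f y"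
    "y \<in> Y \<Longrightarrow> mdist N (Some y) None = f y"
    "mdist N (Some x) (Some y) = mdist U x y" for x y
    unfolding N_def using mdist_one_point_extension[OF Y pos lip kat] by blast+
  have "weight (mtopology_of N) \<le>o m"
  proof -
    obtain D where D: "dense_in (subtopology (mtopology_of U) Y) D" "|D| <o m"
      using top_density_attained dens by metis
    have "subtopology (mtopology_of U) Y = mtopology_of (submetric U Y)"
      by (simp add: mtopology_of_submetric)
    with D have D': "D \<subseteq> Y" "\<And>x r. x \<in> Y \<Longrightarrow> 0 < r \<Longrightarrow> \<exists>y\<in>D. mdist U x y < r"
      using Y by (auto simp: dense_in_mtopology_of)
    \<comment> \<open>A dense subset of \<open>Y\<close> becomes dense in \<open>N\<close> after
      adding \<open>None\<close>; the infinite cardinal \<open>m\<close> absorbs the new point and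
      the countable factor.\<close>
    have "dense_in (mtopology_of N) ({None} \<union> Some ` D)"
      unfolding dense_in_mtopology_of using D' by (auto simp: mspN mdN)
    then have "weight (mtopology_of N) \<le>o |({None} \<union> Some ` D) \<times> (UNIV :: nat set)|"
      by (rule weight_mtopology_of_le)
    also have "|({None} \<union> Some ` D) \<times> (UNIV :: nat set)| \<le>o m"
    proof (rule card_of_Times_ordLeq_infinite_Field)
      have natm: "natLeq \<le>o m" using m(2) by (rule ordLess_imp_ordLeq)
      show inf: "infinite (Field m)"
        using cinfinite_mono[OF natm natLeq_cinfinite] by (simp add: cinfinite_def)
      show nat: "|UNIV :: nat set| \<le>o m" using card_of_nat natm by (rule ordIso_ordLeq_trans)
      show "|{None} \<union> Some ` D| \<le>o m"
      proof (rule card_of_Un_ordLeq_infinite_Field[OF inf])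
        have "|{None :: 'a option}| \<le>o |UNIV :: nat set|"
          by (simp add: card_of_singl_ordLeq)
        then show "|{None :: 'a option}| \<le>o m" using nat by (rule ordLeq_transitive)
        show "|Some ` D| \<le>o m"
          using card_of_image D(2) by (blast intro: ordLess_imp_ordLeq ordLeq_transitive)
      qed (rule m)
    qed (rule m)
    finally show ?thesis .
  qed
  \<comment> \<open>\<open>N\<close> lives on \<open>'a option\<close>, whereas
    \<open>Urysohn_Katetov\<close> speaks of metrics on \<open>'a\<close>; hence the appeal to the
    transferred form of universality.\<close>
  then obtain h where h: "isometric_on N U (mspace N) h"
    using Urysohn_Katetov_universal[OF m sup U] by blast
  define k where "k y = h (Some y)" for y
  have k: "k y \<in> mspace U" if "y \<in> Y" for y
    using h that by (auto simp: isometric_on_def mspN k_def)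
  have kk: "mdist U (k x) (k y) = mdist U x y" if "x \<in> Y" "y \<in> Y" for x y
    using h that by (auto simp: isometric_on_def mspN mdN k_def)
  have iso: "isometric_on U U Y k" using k kk by (auto simp: isometric_on_def)
  have inj: "inj_on k Y"
  proof (rule inj_onI)
    fix x y assume "x \<in> Y" "y \<in> Y" "k x = k y"
    then show "x = y" using kk[of x y] k[of x] Y mdist_zero[of x U y] mdist_zero[of "k x" U "k y"]
      by (metis subsetD)
  qed
  have top: "topspace (subtopology (mtopology_of U) Y) = Y" using Y by auto
  \<comment> \<open>Homogeneity requires small density at both ends, so the bound for
    \<open>Y\<close> is carried over to its copy.\<close>
  have "top_density (subtopology (mtopology_of U) (k ` Y)) \<le>o
      top_density (subtopology (mtopology_of U) Y)"
  proof (rule top_density_image_le)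
    show "continuous_map (subtopology (mtopology_of U) Y) (subtopology (mtopology_of U) (k ` Y)) k"
      by (rule isometric_on_imp_continuous_map[OF iso Y])
    show "k ` topspace (subtopology (mtopology_of U) Y) = topspace (subtopology (mtopology_of U) (k ` Y))"
      unfolding top using k by auto
  qed
  then have densk: "top_density (subtopology (mtopology_of U) (k ` Y)) <o m"
    using dens by (rule ordLeq_ordLess_trans)
  have inv: "isometric_on U U (k ` Y) (inv_into Y k)" "inv_into Y k ` k ` Y = Y"
    using Y inj kk by (auto simp: isometric_on_def)
  have ext: "\<forall>A B f. A \<subseteq> mspace U \<and> B \<subseteq> mspace U \<and>
      top_density (subtopology (mtopology_of U) A) <o m \<and>
      top_density (subtopology (mtopology_of U) B) <o m \<and>
      isometric_on U U A f \<and> f ` A = B \<longrightarrow> (\<exists>g\<in>carrier (Iso U). \<forall>x\<in>A. g x = f x)"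
    using U unfolding Urysohn_Katetov_def by blast
  have "k ` Y \<subseteq> mspace U" using k by blast
  then obtain g where g: "g \<in> carrier (Iso U)" "\<forall>x\<in>k ` Y. g x = inv_into Y k x"
    using ext[rule_format, of "k ` Y" Y "inv_into Y k"] Y densk dens inv by blast
  have hN: "h None \<in> mspace U" using h by (auto simp: isometric_on_def mspN)
  show thesis
  proof (rule that)
    show "g (h None) \<in> mspace U" by (rule Iso_mem(2)[OF g(1) hN])
    fix y assume y: "y \<in> Y"
    have "mdist U (g (h None)) y = mdist U (g (h None)) (g (k y))"
      using g(2) y inj by simp
    also have "\<dots> = mdist U (h None) (k y)" by (rule Iso_mem(3)[OF g(1) hN k[OF y]])
    also have "\<dots> = mdist N None (Some y)" using h y by (simp add: isometric_on_def mspN k_def)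
    finally show "mdist U (g (h None)) y = f y" using y by (simp add: mdN)
  qed
qed

subsection \<open>Distance to a set\<close>

lemma mdist_self: "x \<in> mspace U \<Longrightarrow> mdist U x x = 0"
  by simp

text \<open>For empty \<open>A\<close> the infimum carries no information, hence the nonemptiness
  assumptions in what follows.\<close>

definition mset_dist :: "'a metric \<Rightarrow> 'a set \<Rightarrow> 'a \<Rightarrow> real" where
  "mset_dist U A x = (INF a\<in>A. mdist U x a)"

lemma bdd_below_mdist: "bdd_below ((\<lambda>a. mdist U x a) ` A)"
  by (rule bdd_belowI2[of _ 0]) simp

lemma mset_dist_le: "a \<in> A \<Longrightarrow> mset_dist U A x \<le> mdist U x a"
  unfolding mset_dist_def by (rule cINF_lower[OF bdd_below_mdist])

lemma mset_dist_greatest: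
  "A \<noteq> {} \<Longrightarrow> (\<And>a. a \<in> A \<Longrightarrow> c \<le> mdist U x a) \<Longrightarrow> c \<le> mset_dist U A x"
  unfolding mset_dist_def by (rule cINF_greatest)

lemma mset_dist_nonneg: "A \<noteq> {} \<Longrightarrow> 0 \<le> mset_dist U A x"
  by (rule mset_dist_greatest) auto

lemma mset_dist_less: "A \<noteq> {} \<Longrightarrow> mset_dist U A x < c \<Longrightarrow> \<exists>a\<in>A. mdist U x a < c"
  unfolding mset_dist_def by (simp add: cINF_less_iff bdd_below_mdist)

lemma mset_dist_zero:
  assumes "A \<subseteq> mspace U" "a \<in> A"
  shows "mset_dist U A a = 0"
proof -
  have "mdist U a a = 0" using assms by (intro mdist_self) blast
  then show ?thesis using assms(2) mset_dist_le[of a A U a] mset_dist_nonneg[of A U a] by fastforce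
qed

lemma mset_dist_triangle:
  assumes A: "A \<noteq> {}" "A \<subseteq> mspace U" and x: "x \<in> mspace U" and y: "y \<in> mspace U"
  shows "mset_dist U A x \<le> mdist U x y + mset_dist U A y"
proof -
  have "mset_dist U A x - mdist U x y \<le> mset_dist U A y"
  proof (rule mset_dist_greatest[OF A(1)])
    fix a assume a: "a \<in> A"
    then have "mdist U x a \<le> mdist U x y + mdist U y a" using mdist_triangle[OF x y] A(2) by blast
    then show "mset_dist U A x - mdist U x y \<le> mdist U y a"
      using mset_dist_le[OF a, of U x] by linarith
  qed
  then show ?thesis by linarith
qed

subsection \<open>Groups of isometries\<close>

lemma one_Iso: "x \<in> mspace U \<Longrightarrow> \<one>\<^bsub>Iso U\<^esub> x = x"
  by (simp add: Iso_def BijGroup_def)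

lemma continuous_map_eval:
  "x \<in> mspace U \<Longrightarrow> continuous_map (pointwise_topology U H) (mtopology_of U) (\<lambda>g. g x)"
  unfolding pointwise_topology_def
  by (intro continuous_map_from_subtopology continuous_map_product_projection)

text \<open>A basic open set of the product restricts finitely many coordinates, collected in
  \<open>F\<close>; at the others membership is automatic for a map into the space.\<close>

lemma pointwise_topology_nhd:
  assumes H: "H \<subseteq> carrier (Iso U)" and W: "openin (pointwise_topology U H) W" and f: "f \<in> W"
  obtains F and e :: real where "finite F" "F \<subseteq> mspace U" "0 < e"
    "\<And>g. g \<in> H \<Longrightarrow> (\<And>x. x \<in> F \<Longrightarrow> mdist U (f x) (g x) < e) \<Longrightarrow> g \<in> W"
proof -
  obtain S where S: "openin (product_topology (\<lambda>_. mtopology_of U) (mspace U)) S" "W = S \<inter> H"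
    using W unfolding pointwise_topology_def openin_subtopology by blast
  then obtain N where N: "finite {x \<in> mspace U. N x \<noteq> mspace U}"
      "\<And>x. x \<in> mspace U \<Longrightarrow> openin (mtopology_of U) (N x)"
      "f \<in> Pi\<^sub>E (mspace U) N" "Pi\<^sub>E (mspace U) N \<subseteq> S"
    using f unfolding openin_product_topology_alt by force
  define F where "F = {x \<in> mspace U. N x \<noteq> mspace U}"
  have "\<exists>r>0. \<forall>y\<in>mspace U. mdist U (f x) y < r \<longrightarrow> y \<in> N x" if "x \<in> mspace U" for x
    using N(2)[OF that] N(3) that unfolding openin_mtopology_of by blast
  then obtain r where r: "\<And>x. x \<in> mspace U \<Longrightarrow> 0 < r x"
    "\<And>x y. x \<in> mspace U \<Longrightarrow> y \<in> mspace U \<Longrightarrow> mdist U (f x) y < r x \<Longrightarrow> y \<in> N x"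
    by metis
  \<comment> \<open>The inserted 1 keeps the minimum meaningful when \<open>F\<close> is
    empty.\<close>
  define e where "e = Min (insert 1 (r ` F))"
  have finF: "finite F" using N(1) by (simp add: F_def)
  show thesis
  proof (rule that)
    show "finite F" by (rule finF)
    show "F \<subseteq> mspace U" by (auto simp: F_def)
    show "0 < e" using finF r(1) by (auto simp: e_def F_def)
    fix g assume g: "g \<in> H" "\<And>x. x \<in> F \<Longrightarrow> mdist U (f x) (g x) < e"
    note gI = Iso_mem[OF subsetD[OF H g(1)]]
    have "g x \<in> N x" if x: "x \<in> mspace U" for x
    proof (cases "x \<in> F")
      case True
      then have "e \<le> r x" using finF by (simp add: e_def)
      then show ?thesis using r(2)[OF x gI(2)[OF x]] g(2)[OF True] by simp
    next
      case False
      then show ?thesis using x gI(2)[OF x] by (simp add: F_def)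
    qed
    then have "g \<in> Pi\<^sub>E (mspace U) N" using gI(4) by (simp add: PiE_iff)
    then show "g \<in> W" using N(4) S(2) g(1) by blast
  qed
qed

section \<open>A criterion for SIN\<close>

text \<open>The union of all conjugates of \<open>V\<close> is invariant and open, and still lies in
  \<open>W\<close>.\<close>

lemma (in topological_group) SIN_groupI:
  assumes *: "\<And>W. openin T W \<Longrightarrow> \<one> \<in> W \<Longrightarrow>
    \<exists>V. openin T V \<and> \<one> \<in> V \<and> (\<forall>g\<in>carrier G. \<forall>x\<in>V. g \<otimes> x \<otimes> inv g \<in> W)"
  shows "SIN_group G T"
  unfolding SIN_group_def
proof (intro conjI allI impI)
  show "topological_group G T" by (rule topological_group_axioms)
  fix W assume W: "openin T W \<and> \<one> \<in> W"
  obtain V where V: "openin T V" "\<one> \<in> V"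
    and VW: "\<And>g x. g \<in> carrier G \<Longrightarrow> x \<in> V \<Longrightarrow> g \<otimes> x \<otimes> inv g \<in> W"
    using *[OF conjunct1[OF W] conjunct2[OF W]] by metis
  define c where "c g x = g \<otimes> x \<otimes> inv g" for g x
  have c_closed: "c g x \<in> carrier G" if "g \<in> carrier G" "x \<in> carrier G" for g x
    using that by (simp add: c_def)
  have c_c: "c g (c h x) = c (g \<otimes> h) x"
    if "g \<in> carrier G" "h \<in> carrier G" "x \<in> carrier G" for g h x
    using that by (simp add: c_def m_assoc inv_mult_group)
  have c_one: "c \<one> x = x" if "x \<in> carrier G" for x using that by (simp add: c_def)
  have c_cont: "continuous_map T T (c g)" if g: "g \<in> carrier G" for g
  proof -
    have mult: "continuous_map T T (\<lambda>x. u x \<otimes> v x)"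
      if "continuous_map T T u" "continuous_map T T v" for u v
      using continuous_map_compose[OF continuous_map_pairedI[OF that] continuous_mult]
      by (simp add: o_def)
    show ?thesis unfolding c_def
      by (intro mult) (use g in \<open>simp_all add: topspace_eq\<close>)
  qed
  \<comment> \<open>The conjugates of \<open>V\<close> enter as preimages under \<open>c g\<close>,
    so that openness follows from the continuity of conjugation.\<close>
  define O' where "O' = (\<Union>g\<in>carrier G. {x \<in> topspace T. c g x \<in> V})"
  have O': "x \<in> O' \<longleftrightarrow> x \<in> carrier G \<and> (\<exists>g\<in>carrier G. c g x \<in> V)" for x
    by (auto simp: O'_def topspace_eq)
  have "openin T O'"
    unfolding O'_def using c_cont V(1) by (intro openin_Union) (auto intro: openin_continuous_map_preimage)
  moreover have "\<one> \<in> O'" using V(2) c_one[of \<one>] by (auto simp: O' intro!: bexI[of _ \<one>])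
  moreover have "O' \<subseteq> W"
  proof
    fix x assume "x \<in> O'"
    then obtain g where g: "x \<in> carrier G" "g \<in> carrier G" "c g x \<in> V" by (auto simp: O')
    then have "c (inv g) (c g x) \<in> W" using VW[of "inv g"] by (simp add: c_def)
    then show "x \<in> W" using g by (simp add: c_c c_one)
  qed
  moreover have "c g ` O' = O'" if g: "g \<in> carrier G" for g
  proof -
    have sub: "c g x \<in> O'" if g: "g \<in> carrier G" and x: "x \<in> O'" for g x
    proof -
      obtain h where h: "x \<in> carrier G" "h \<in> carrier G" "c h x \<in> V" using x by (auto simp: O')
      then have "c (h \<otimes> inv g) (c g x) \<in> V" using g by (simp add: c_c m_assoc)
      then show ?thesis using h g c_closed unfolding O' by blast
    qed
    have "x \<in> c g ` O'" if x: "x \<in> O'" for x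
    proof (rule image_eqI)
      show "c (inv g) x \<in> O'" using sub g x by simp
      have "x \<in> carrier G" using x O' by blast
      then show "x = c g (c (inv g) x)" using g by (simp add: c_c c_one)
    qed
    with sub[OF g] show ?thesis by blast
  qed
  ultimately show "\<exists>V. openin T V \<and> \<one> \<in> V \<and> V \<subseteq> W \<and>
      (\<forall>g\<in>carrier G. (\<lambda>x. g \<otimes> x \<otimes> inv g) ` V = V)"
    unfolding c_def by blast
qed

text \<open>Since d(x, g w g^-1 x) = d(g^-1 x, w g^-1 x), all conjugates of \<open>w\<close> move
  \<open>x\<close> little as soon as \<open>w\<close> moves every point of the orbit of
  \<open>x\<close> little.\<close>

lemma SIN_group_pointwise_topology:
  assumes sub: "subgroup H (Iso U)"
    and small: "\<And>x e. x \<in> mspace U \<Longrightarrow> 0 < e \<Longrightarrow> \<exists>V. openin (pointwise_topology U H) V \<and>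
      \<one>\<^bsub>Iso U\<^esub> \<in> V \<and> (\<forall>w\<in>V. \<forall>y\<in>(\<lambda>g. g x) ` H. mdist U y (w y) < e)"
  shows "SIN_group (Iso U\<lparr>carrier := H\<rparr>) (pointwise_topology U H)"
proof (rule topological_group.SIN_groupI[OF topological_group_Iso[OF sub]], goal_cases)
  case (1 W)
  interpret group "Iso U" by (rule group_Iso)
  interpret H: subgroup H "Iso U" by (rule sub)
  let ?T = "pointwise_topology U H"
  have H: "H \<subseteq> carrier (Iso U)" by (rule H.subset)
  obtain F and e :: real where F: "finite F" "F \<subseteq> mspace U" "0 < e"
    and FW: "\<And>g. g \<in> H \<Longrightarrow> (\<And>x. x \<in> F \<Longrightarrow> mdist U (\<one>\<^bsub>Iso U\<^esub> x) (g x) < e) \<Longrightarrow> g \<in> W"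
    using pointwise_topology_nhd[OF H 1(1) 1(2)[simplified]] by metis
  have "\<forall>x\<in>F. \<exists>V. openin ?T V \<and> \<one>\<^bsub>Iso U\<^esub> \<in> V \<and>
      (\<forall>w\<in>V. \<forall>y\<in>(\<lambda>g. g x) ` H. mdist U y (w y) < e)"
    using small F by blast
  then obtain V where V: "\<And>x. x \<in> F \<Longrightarrow> openin ?T (V x)" "\<And>x. x \<in> F \<Longrightarrow> \<one>\<^bsub>Iso U\<^esub> \<in> V x"
    "\<And>x w g. x \<in> F \<Longrightarrow> w \<in> V x \<Longrightarrow> g \<in> H \<Longrightarrow> mdist U (g x) (w (g x)) < e"
    by (metis (no_types, lifting) imageI)
  \<comment> \<open>Intersecting with the whole space covers the case of empty \<open>F\<close>,
    where the intersection over \<open>F\<close> is \<open>UNIV\<close>.\<close>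
  define V' where "V' = topspace ?T \<inter> \<Inter>(V ` F)"
  have "openin ?T V'"
    unfolding V'_def using F(1) V(1) by (intro openin_Int_Inter) auto
  moreover have "\<one>\<^bsub>Iso U\<^esub> \<in> V'"
    using V(2) by (simp add: V'_def topspace_pointwise_topology[OF H])
  moreover have "g \<otimes>\<^bsub>Iso U\<^esub> w \<otimes>\<^bsub>Iso U\<^esub> inv\<^bsub>Iso U\<^esub> g \<in> W" if g: "g \<in> H" and w: "w \<in> V'" for g w
  proof (rule FW)
    have wH: "w \<in> H" using w by (simp add: V'_def topspace_pointwise_topology[OF H])
    show "g \<otimes>\<^bsub>Iso U\<^esub> w \<otimes>\<^bsub>Iso U\<^esub> inv\<^bsub>Iso U\<^esub> g \<in> H" using g wH by simp
    fix x assume x: "x \<in> F"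
    then have xU: "x \<in> mspace U" using F by blast
    note c = subsetD[OF H g] subsetD[OF H wH] inv_closed[OF subsetD[OF H g]]
    \<comment> \<open>\<open>z\<close> lies in the orbit of \<open>x\<close>, so the bound for
      elements of \<open>V x\<close> applies to it.\<close>
    define z where "z = (inv\<^bsub>Iso U\<^esub> g) x"
    have z: "z \<in> mspace U" "g z = x" unfolding z_def by (rule inv_Iso[OF c(1) xU])+
    have "(g \<otimes>\<^bsub>Iso U\<^esub> w \<otimes>\<^bsub>Iso U\<^esub> inv\<^bsub>Iso U\<^esub> g) x = g (w z)"
      using xU z by (simp only: mult_Iso[OF c(1,2)]
          mult_Iso[OF m_closed[OF c(1,2)] c(3), unfolded mult_Iso[OF c(1,2)]] compose_eq z_def)
    then have "mdist U (\<one>\<^bsub>Iso U\<^esub> x) ((g \<otimes>\<^bsub>Iso U\<^esub> w \<otimes>\<^bsub>Iso U\<^esub> inv\<^bsub>Iso U\<^esub> g) x) = mdist U (g z) (g (w z))"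
      using z(2) xU by (simp add: one_Iso)
    also have "\<dots> = mdist U z (w z)"
      by (rule Iso_mem(3)[OF c(1) z(1) Iso_mem(2)[OF c(2) z(1)]])
    also have "\<dots> < e"
      unfolding z_def using V(3)[OF x _ H.m_inv_closed[OF g]] w x by (auto simp: V'_def)
    finally show "mdist U (\<one>\<^bsub>Iso U\<^esub> x) ((g \<otimes>\<^bsub>Iso U\<^esub> w \<otimes>\<^bsub>Iso U\<^esub> inv\<^bsub>Iso U\<^esub> g) x) < e" .
  qed
  ultimately show ?case
    using m_inv_consistent[OF sub] by (intro exI[of _ V']) auto
qed

section \<open>Density and boundedness of orbits\<close>

lemma top_density_orbit:
  assumes H: "H \<subseteq> carrier (Iso U)" and x: "x \<in> mspace U"
  shows "top_density (subtopology (mtopology_of U) ((\<lambda>g. g x) ` H)) \<le>o top_density (pointwise_topology U H)"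
proof (rule top_density_image_le)
  show "continuous_map (pointwise_topology U H) (subtopology (mtopology_of U) ((\<lambda>g. g x) ` H)) (\<lambda>g. g x)"
    using continuous_map_eval[OF x] by (auto simp: continuous_map_in_subtopology topspace_pointwise_topology[OF H])
  show "(\<lambda>g. g x) ` topspace (pointwise_topology U H) = topspace (subtopology (mtopology_of U) ((\<lambda>g. g x) ` H))"
    using Iso_mem(2)[OF subsetD[OF H] x] by (auto simp: topspace_pointwise_topology[OF H])
qed

text \<open>Pulling the metric back along evaluation at \<open>x\<close> gives a continuous
  left-invariant pseudometric on the group, which (OB) bounds.\<close>

lemma property_OB_orbit_bounded:
  assumes sub: "subgroup H (Iso U)"
    and OB: "property_OB (Iso U\<lparr>carrier := H\<rparr>) (pointwise_topology U H)"
    and x: "x \<in> mspace U"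
  obtains C where "0 < C" "\<And>y z. y \<in> (\<lambda>g. g x) ` H \<Longrightarrow> z \<in> (\<lambda>g. g x) ` H \<Longrightarrow> mdist U y z \<le> C"
proof -
  interpret group "Iso U" by (rule group_Iso)
  interpret H: subgroup H "Iso U" by (rule sub)
  let ?T = "pointwise_topology U H"
  note I = Iso_mem[OF H.mem_carrier]
  let ?p = "\<lambda>g h. mdist U (g x) (h x)"
  have "pseudometric_on H ?p"
    unfolding pseudometric_on_def using I(2) x by (auto simp: mdist_commute intro: mdist_triangle)
  moreover have "continuous_map (prod_topology ?T ?T) euclideanreal (\<lambda>(g, h). ?p g h)"
  proof -
    have "continuous_map (prod_topology ?T ?T) (mtopology_of U) (\<lambda>q. fst q x)"
      "continuous_map (prod_topology ?T ?T) (mtopology_of U) (\<lambda>q. snd q x)"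
      using continuous_map_compose[OF continuous_map_fst continuous_map_eval[OF x]]
        continuous_map_compose[OF continuous_map_snd continuous_map_eval[OF x]]
      by (simp_all add: o_def)
    then show ?thesis
      unfolding case_prod_unfold
      by (rule continuous_map_mdist)
  qed
  moreover have "?p (g \<otimes>\<^bsub>Iso U\<^esub> h) (g \<otimes>\<^bsub>Iso U\<^esub> k) = ?p h k" if "g \<in> H" "h \<in> H" "k \<in> H" for g h k
    using that x I(2,3) by (simp add: mult_Iso compose_eq)
  ultimately have "\<exists>C. \<forall>g\<in>H. \<forall>h\<in>H. ?p g h \<le> C"
    using conjunct2[OF OB[unfolded property_OB_def], rule_format, of ?p] by auto
  then obtain C where C: "\<forall>g\<in>H. \<forall>h\<in>H. ?p g h \<le> C" ..
  show thesis
  proof (rule that)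
    \<comment> \<open>The constant is made positive because the Katetov function built from it has
      to be positive also at the points of \<open>A\<close>.\<close>
    show "0 < max C 1" by simp
    fix y z assume "y \<in> (\<lambda>g. g x) ` H" "z \<in> (\<lambda>g. g x) ` H"
    then have "mdist U y z \<le> C" using C by blast
    then show "mdist U y z \<le> max C 1" by simp
  qed
qed

subsection \<open>Uniform smallness on an orbit\<close>

text \<open>The point \<open>z\<close> turns the distance from a set into the distance from a point,
  up to a constant. By the triangle inequality d(z, w y) differs from d(z, y) = d(w z, w y) by at
  most d(z, w z), and this bound does not depend on \<open>y\<close>.\<close>

lemma mset_dist_orbit_equicontinuous:
  fixes m :: "'m rel" and U :: "'a metric"
  assumes m: "Card_order m" "natLeq <o m"
    and sup: "is_card_sup {m ^c n | n :: 'm rel. Card_order n \<and> n <o m} m"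
    and U: "Urysohn_Katetov m U"
    and sub: "subgroup H (Iso U)"
    and dens: "top_density (pointwise_topology U H) <o m"
    and OB: "property_OB (Iso U\<lparr>carrier := H\<rparr>) (pointwise_topology U H)"
    and x: "x \<in> mspace U"
    and A: "A \<subseteq> (\<lambda>g. g x) ` H" "A \<noteq> {}" and e: "0 < e"
  shows "\<exists>V. openin (pointwise_topology U H) V \<and> \<one>\<^bsub>Iso U\<^esub> \<in> V \<and>
    (\<forall>w\<in>V. \<forall>y\<in>(\<lambda>g. g x) ` H. \<bar>mset_dist U A (w y) - mset_dist U A y\<bar> < e)"
proof -
  interpret group "Iso U" by (rule group_Iso)
  interpret H: subgroup H "Iso U" by (rule sub)
  have H: "H \<subseteq> carrier (Iso U)" by (rule H.subset)
  note I = Iso_mem[OF H.mem_carrier]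
  define Y where "Y = (\<lambda>g. g x) ` H"
  have Y: "Y \<subseteq> mspace U" using I(2) x by (auto simp: Y_def)
  have AU: "A \<subseteq> mspace U" using A Y by (auto simp: Y_def)
  have densY: "top_density (subtopology (mtopology_of U) Y) <o m"
    using top_density_orbit[OF H x] dens unfolding Y_def by (rule ordLeq_ordLess_trans)
  obtain C where C: "0 < C" "\<And>y z. y \<in> Y \<Longrightarrow> z \<in> Y \<Longrightarrow> mdist U y z \<le> C"
    using property_OB_orbit_bounded[OF sub OB x] unfolding Y_def by metis
  \<comment> \<open>Since the orbit has diameter at most \<open>C\<close>, adding \<open>C\<close> to the distance from \<open>A\<close> makes it
    a Katetov function.\<close>
  obtain z where z: "z \<in> mspace U" "\<And>y. y \<in> Y \<Longrightarrow> mdist U z y = C + mset_dist U A y"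
  proof (rule Urysohn_Katetov_one_point_extension[OF m sup U Y densY, of "\<lambda>y. C + mset_dist U A y"])
    fix z
    assume "z \<in> mspace U" "\<And>y. y \<in> Y \<Longrightarrow> mdist U z y = C + mset_dist U A y"
    then show thesis by (rule that)
  next
    show "0 < C + mset_dist U A y" for y
      using C(1) mset_dist_nonneg[OF A(2), of U y] by simp
    show "C + mset_dist U A y \<le> mdist U y y' + (C + mset_dist U A y')"
      if "y \<in> Y" "y' \<in> Y" for y y'
      using mset_dist_triangle[OF A(2) AU subsetD[OF Y that(1)] subsetD[OF Y that(2)]] by simp
    show "mdist U y y' \<le> C + mset_dist U A y + (C + mset_dist U A y')"
      if "y \<in> Y" "y' \<in> Y" for y y'
      using C(1) C(2)[OF that] mset_dist_nonneg[OF A(2), of U y] mset_dist_nonneg[OF A(2), of U y']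
      by simp
  qed
  define V where "V = {w \<in> H. mdist U z (w z) < e}"
  have "\<bar>mset_dist U A (w y) - mset_dist U A y\<bar> < e" if w: "w \<in> V" and y: "y \<in> Y" for w y
  proof -
    have wH: "w \<in> H" and wz: "mdist U z (w z) < e" using w by (auto simp: V_def)
    have yU: "y \<in> mspace U" using y Y by blast
    obtain g where g: "g \<in> H" "y = g x" using y by (auto simp: Y_def)
    \<comment> \<open>The distances of \<open>z\<close> are prescribed on the orbit alone, so
      \<open>w y\<close> must be seen to stay in it.\<close>
    then have "w y = (w \<otimes>\<^bsub>Iso U\<^esub> g) x"
      using x wH by (simp add: mult_Iso compose_eq)
    then have wy: "w y \<in> Y" using wH g(1) unfolding Y_def by blast
    have "mdist U (w z) (w y) = mdist U z y" by (rule I(3)[OF wH z(1) yU])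
    moreover have "mdist U z (w y) \<le> mdist U z (w z) + mdist U (w z) (w y)"
      "mdist U (w z) (w y) \<le> mdist U (w z) z + mdist U z (w y)"
      using I(2)[OF wH] z(1) yU by (auto intro: mdist_triangle)
    ultimately have "\<bar>mdist U z (w y) - mdist U z y\<bar> < e"
      using wz by (simp add: mdist_commute)
    then show ?thesis using z(2)[OF y] z(2)[OF wy] by simp
  qed
  moreover have "openin (pointwise_topology U H) V"
    unfolding V_def by (rule openin_pointwise_topology[OF H z(1) z(1)])
  moreover have "\<one>\<^bsub>Iso U\<^esub> \<in> V" using z(1) e by (simp add: V_def one_Iso mdist_self)
  ultimately show ?thesis unfolding Y_def by blast
qed

section \<open>The metrizable case\<close>

text \<open>Ramsey's theorem makes the relation \<open>near\<close> uniform on the pairs in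
  \<open>I\<close>. Were it to hold in either direction, a path of three steps shorter than e / 4
  would join some \<open>a i\<close> to \<open>b i\<close>, which are at least \<open>e\<close>
  apart.\<close>

lemma separated_subsequence:
  fixes a b :: "nat \<Rightarrow> 'a"
  assumes a: "\<And>n. a n \<in> mspace U" and b: "\<And>n. b n \<in> mspace U"
    and ab: "\<And>n. e \<le> mdist U (a n) (b n)" and e: "0 < e"
  obtains I where "infinite I" "\<And>n k. n \<in> I \<Longrightarrow> k \<in> I \<Longrightarrow> e / 4 \<le> mdist U (a n) (b k)"
proof -
  define near where "near n k \<longleftrightarrow> mdist U (a n) (b k) < e / 4" for n k
  \<comment> \<open>Ramsey's theorem colours unordered pairs, so the order is recovered through
    \<open>Min\<close> and \<open>Max\<close>; the summands 1 and 2 record \<open>near\<close> in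
    the two directions.\<close>
  define col where "col X = (if near (Min X) (Max X) then 1 else 0) +
    (if near (Max X) (Min X) then 2 else (0 :: nat))" for X
  have "\<forall>n\<in>UNIV. \<forall>k\<in>UNIV. n \<noteq> k \<longrightarrow> col {n, k} < 4" by (simp add: col_def)
  from Ramsey2[OF infinite_UNIV_nat this] obtain I t where I: "infinite I"
    and t: "\<forall>n\<in>I. \<forall>k\<in>I. n \<noteq> k \<longrightarrow> col {n, k} = t"
    by (elim exE conjE) (rule that)
  have col: "col {n, k} = (if near n k then 1 else 0) + (if near k n then 2 else 0)" if "n < k" for n k
    using that by (simp add: col_def min_def max_def)
  have hom: "(near n k \<longleftrightarrow> near n' k') \<and> (near k n \<longleftrightarrow> near k' n')"
    if "n \<in> I" "k \<in> I" "n < k" "n' \<in> I" "k' \<in> I" "n' < k'" for n k n' k'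
  proof -
    have "col {n, k} = col {n', k'}"
      using t that by simp
    then show ?thesis unfolding col[OF that(3)] col[OF that(6)] by (simp split: if_splits)
  qed
  obtain n1 where n1: "n1 \<in> I" using I by (metis finite.emptyI ex_in_conv)
  obtain n2 where n2: "n2 \<in> I" "n1 < n2" using I infinite_nat_iff_unbounded by blast
  obtain n3 where n3: "n3 \<in> I" "n2 < n3" using I infinite_nat_iff_unbounded by blast
  have n13: "n1 < n3" using n2 n3 by simp
  \<comment> \<open>The path runs from \<open>a i\<close> over \<open>b k\<close> and
    \<open>a j\<close> to \<open>b i\<close>.\<close>
  have chain: "\<not> (near i k \<and> near j k \<and> near j i)" for i j k
  proof
    assume *: "near i k \<and> near j k \<and> near j i"
    have "mdist U (a i) (b i) \<le> mdist U (a i) (b k) + mdist U (b k) (b i)"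
      "mdist U (b k) (b i) \<le> mdist U (b k) (a j) + mdist U (a j) (b i)"
      by (rule mdist_triangle; rule a b)+
    with * ab[of i] e show False by (simp add: near_def mdist_commute)
  qed
  have "\<not> near n k" if nk: "n \<in> I" "k \<in> I" for n k
  proof
    assume near: "near n k"
    have "n \<noteq> k" using near ab[of n] e by (auto simp: near_def)
    then consider "n < k" | "k < n" by linarith
    then show False
    proof cases
      case 1
      have "near i j" if "i \<in> I" "j \<in> I" "i < j" for i j
        using hom[OF nk 1 that] near by simp
      \<comment> \<open>These indices make all three pairs in \<open>chain\<close> ascending; in the
        other case they are all descending.\<close>
      then show False using chain[where i=n2 and j=n1 and k=n3] n1 n2 n3 n13 by simp
    next
      case 2
      have "near j i" if "i \<in> I" "j \<in> I" "i < j" for i j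
        using hom[OF nk(2,1) 2 that] near by simp
      then show False using chain[where i=n2 and j=n3 and k=n1] n1 n2 n3 n13 by simp
    qed
  qed
  then show thesis using I by (intro that[of I]) (auto simp: near_def not_less)
qed

text \<open>Metrizability allows the bad elements to be chosen as a sequence in shrinking balls at
  the identity. The set to which \<open>equi\<close> is applied consists of the points
  \<open>y k\<close> of a subsequence: its distance is 0 at \<open>y n\<close> and at least e / 4 at
  \<open>w n (y n)\<close>.\<close>

lemma uniformly_small_metrizable:
  assumes H: "H \<subseteq> carrier (Iso U)" and one: "\<one>\<^bsub>Iso U\<^esub> \<in> H" and Y: "Y \<subseteq> mspace U"
    and equi: "\<And>A e. A \<subseteq> Y \<Longrightarrow> A \<noteq> {} \<Longrightarrow> 0 < e \<Longrightarrow>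
      \<exists>V. openin (pointwise_topology U H) V \<and> \<one>\<^bsub>Iso U\<^esub> \<in> V \<and>
        (\<forall>w\<in>V. \<forall>y\<in>Y. \<bar>mset_dist U A (w y) - mset_dist U A y\<bar> < e)"
    and metr: "metrizable_space (pointwise_topology U H)" and e: "0 < e"
  shows "\<exists>V. openin (pointwise_topology U H) V \<and> \<one>\<^bsub>Iso U\<^esub> \<in> V \<and>
    (\<forall>w\<in>V. \<forall>y\<in>Y. mdist U y (w y) < e)"
proof (rule ccontr)
  assume neg: "\<not> ?thesis"
  obtain M d where "Metric_space M d" and T: "pointwise_topology U H = Metric_space.mtopology M d"
    using metr unfolding metrizable_space_def by blast
  then interpret Metric_space M d by simp
  have M: "M = H" using topspace_pointwise_topology[OF H] T by simp
  have oneM: "\<one>\<^bsub>Iso U\<^esub> \<in> M" using one M by simp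
  have "\<exists>w y. w \<in> mball \<one>\<^bsub>Iso U\<^esub> (1 / Suc n) \<and> y \<in> Y \<and> e \<le> mdist U y (w y)" for n
  proof -
    have "openin (pointwise_topology U H) (mball \<one>\<^bsub>Iso U\<^esub> (1 / Suc n))"
      "\<one>\<^bsub>Iso U\<^esub> \<in> mball \<one>\<^bsub>Iso U\<^esub> (1 / Suc n)"
      unfolding T using oneM by simp_all
    with neg show ?thesis by (meson not_less)
  qed
  then obtain w y where w: "\<And>n. w n \<in> mball \<one>\<^bsub>Iso U\<^esub> (1 / Suc n)"
    and y: "\<And>n. y n \<in> Y" and far: "\<And>n. e \<le> mdist U (y n) (w n (y n))"
    by metis
  have yU: "y n \<in> mspace U" for n using y Y by blast
  have wU: "w n (y n) \<in> mspace U" for n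
  proof -
    have "w n \<in> H" using w[of n] M by (metis in_mball)
    then show ?thesis by (rule Iso_mem(2)[OF subsetD[OF H] yU])
  qed
  have far': "e \<le> mdist U (w n (y n)) (y n)" for n using far by (simp add: mdist_commute)
  \<comment> \<open>With \<open>w n (y n)\<close> in the role of \<open>a n\<close> and
    \<open>y n\<close> in that of \<open>b n\<close>, each moved point is kept away from all unmoved
    points of the subsequence.\<close>
  obtain I where I: "infinite I"
    and sep: "\<And>n k. n \<in> I \<Longrightarrow> k \<in> I \<Longrightarrow> e / 4 \<le> mdist U (w n (y n)) (y k)"
    using separated_subsequence[of "\<lambda>n. w n (y n)" U y e] wU yU far' e by metis
  have A: "y ` I \<subseteq> Y" "y ` I \<noteq> {}" using y I by auto
  obtain V where V: "openin mtopology V" "\<one>\<^bsub>Iso U\<^esub> \<in> V"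
    and Ve: "\<And>v z. v \<in> V \<Longrightarrow> z \<in> Y \<Longrightarrow> \<bar>mset_dist U (y ` I) (v z) - mset_dist U (y ` I) z\<bar> < e / 4"
    using equi[OF A, of "e / 4"] e unfolding T by auto
  obtain r where r: "0 < r" "mball \<one>\<^bsub>Iso U\<^esub> r \<subseteq> V"
    using V unfolding openin_mtopology by blast
  obtain N where N: "1 / Suc N < r" using nat_approx_posE[OF r(1)] by blast
  \<comment> \<open>An index of the subsequence so large that \<open>w n\<close> lies in
    \<open>V\<close>.\<close>
  obtain n where n: "n \<in> I" "N < n" using I infinite_nat_iff_unbounded by blast
  have "1 / real (Suc n) \<le> 1 / Suc N" using n by (intro divide_left_mono) auto
  then have "w n \<in> V" using w[of n] N r(2) by auto
  then have "\<bar>mset_dist U (y ` I) (w n (y n)) - mset_dist U (y ` I) (y n)\<bar> < e / 4"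
    by (rule Ve[OF _ y])
  moreover have "mset_dist U (y ` I) (y n) = 0"
    by (rule mset_dist_zero) (use A Y n in auto)
  moreover have "e / 4 \<le> mset_dist U (y ` I) (w n (y n))"
    by (rule mset_dist_greatest[OF A(2)]) (use sep[OF n(1)] in auto)
  ultimately show False by linarith
qed

section \<open>The locally connected case\<close>

text \<open>Zorn's lemma applies because two points of the union of a chain already lie in a common
  member. The case \<open>y \<in> A\<close> is listed apart since d(y, y) < e may fail for arbitrary
  \<open>e\<close> and \<open>Y\<close>.\<close>

lemma maximal_separated_subset:
  fixes e :: real
  obtains A where "A \<subseteq> Y" "\<And>a b. a \<in> A \<Longrightarrow> b \<in> A \<Longrightarrow> a \<noteq> b \<Longrightarrow> e \<le> mdist U a b"
    "\<And>y. y \<in> Y \<Longrightarrow> y \<in> A \<or> (\<exists>a\<in>A. mdist U y a < e)"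
proof -
  define \<S> where "\<S> = {A. A \<subseteq> Y \<and> (\<forall>a\<in>A. \<forall>b\<in>A. a \<noteq> b \<longrightarrow> e \<le> mdist U a b)}"
  have "\<Union>\<C> \<in> \<S>" if \<C>: "subset.chain \<S> \<C>" for \<C>
  proof -
    have sub: "\<C> \<subseteq> \<S>" and tot: "\<And>A B. A \<in> \<C> \<Longrightarrow> B \<in> \<C> \<Longrightarrow> A \<subseteq> B \<or> B \<subseteq> A"
      using \<C> unfolding subset_chain_def by auto
    have "e \<le> mdist U a b" if ab: "a \<in> \<Union>\<C>" "b \<in> \<Union>\<C>" "a \<noteq> b" for a b
    proof -
      obtain A B where "A \<in> \<C>" "a \<in> A" "B \<in> \<C>" "b \<in> B" using ab by blast
      then obtain D where "D \<in> \<C>" "a \<in> D" "b \<in> D" using tot by blast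
      then show ?thesis using sub ab(3) unfolding \<S>_def by blast
    qed
    moreover have "\<Union>\<C> \<subseteq> Y" using sub unfolding \<S>_def by blast
    ultimately show ?thesis unfolding \<S>_def by blast
  qed
  then obtain A where A: "A \<in> \<S>" "\<And>B. B \<in> \<S> \<Longrightarrow> A \<subseteq> B \<Longrightarrow> B = A"
    using subset_Zorn'[of \<S>] by blast
  show thesis
  proof (rule that)
    show "A \<subseteq> Y" "\<And>a b. a \<in> A \<Longrightarrow> b \<in> A \<Longrightarrow> a \<noteq> b \<Longrightarrow> e \<le> mdist U a b"
      using A(1) unfolding \<S>_def by blast+
    fix y assume y: "y \<in> Y"
    show "y \<in> A \<or> (\<exists>a\<in>A. mdist U y a < e)"
    proof (rule ccontr)
      assume *: "\<not> ?thesis"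
      then have "\<forall>a\<in>A. e \<le> mdist U y a \<and> e \<le> mdist U a y"
        by (simp add: mdist_commute not_less)
      then have "insert y A \<in> \<S>" using A(1) y unfolding \<S>_def by blast
      then show False using A(2) * by blast
    qed
  qed
qed

text \<open>The distance from a maximal separated set \<open>A\<close> locates a moved point of
  \<open>A\<close> near some point of \<open>A\<close>, and connectedness forces that point to be
  the original one. Maximality spreads the bound from \<open>A\<close> to \<open>Y\<close>.\<close>

lemma uniformly_small_locally_connected:
  assumes H: "H \<subseteq> carrier (Iso U)" and one: "\<one>\<^bsub>Iso U\<^esub> \<in> H" and Y: "Y \<subseteq> mspace U"
    and equi: "\<And>A e. A \<subseteq> Y \<Longrightarrow> A \<noteq> {} \<Longrightarrow> 0 < e \<Longrightarrow>
      \<exists>V. openin (pointwise_topology U H) V \<and> \<one>\<^bsub>Iso U\<^esub> \<in> V \<and>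
        (\<forall>w\<in>V. \<forall>y\<in>Y. \<bar>mset_dist U A (w y) - mset_dist U A y\<bar> < e)"
    and lc: "locally_connected_space (pointwise_topology U H)" and e: "0 < e"
  shows "\<exists>V. openin (pointwise_topology U H) V \<and> \<one>\<^bsub>Iso U\<^esub> \<in> V \<and>
    (\<forall>w\<in>V. \<forall>y\<in>Y. mdist U y (w y) < e)"
proof (cases "Y = {}")
  case True
  then show ?thesis
    using one openin_topspace[of "pointwise_topology U H"]
    by (intro exI[of _ H]) (simp add: topspace_pointwise_topology[OF H])
next
  case False
  let ?T = "pointwise_topology U H"
  \<comment> \<open>The final estimate adds two lengths below \<open>r\<close>, namely d(y, a) and
    d(w a, w y), and one below r / 2, namely d(a, w a).\<close>
  define r where "r = e / 3"
  have r: "0 < r" "e = 3 * r" using e by (simp_all add: r_def)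
  obtain A where A: "A \<subseteq> Y" and sep: "\<And>a b. a \<in> A \<Longrightarrow> b \<in> A \<Longrightarrow> a \<noteq> b \<Longrightarrow> r \<le> mdist U a b"
    and max: "\<And>y. y \<in> Y \<Longrightarrow> y \<in> A \<or> (\<exists>a\<in>A. mdist U y a < r)"
    using maximal_separated_subset[of Y r U] by metis
  have AU: "a \<in> mspace U" if "a \<in> A" for a using A Y that by blast
  have near_A: "\<exists>a\<in>A. mdist U y a < r" if "y \<in> Y" for y
    using max[OF that] r(1) mdist_self[OF subsetD[OF Y that]] by force
  have "A \<noteq> {}" using near_A False by blast
  then obtain V0 where V0: "openin ?T V0" "\<one>\<^bsub>Iso U\<^esub> \<in> V0"
    "\<And>w y. w \<in> V0 \<Longrightarrow> y \<in> Y \<Longrightarrow> \<bar>mset_dist U A (w y) - mset_dist U A y\<bar> < r / 2"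
    using equi[OF A, of "r / 2"] r(1) by auto
  obtain V where V: "openin ?T V" "connectedin ?T V" "\<one>\<^bsub>Iso U\<^esub> \<in> V" "V \<subseteq> V0"
    using lc V0(1,2) unfolding locally_connected_space_alt neighbourhood_base_of by blast
  have VH: "V \<subseteq> H" using openin_subset[OF V(1)] by (simp add: topspace_pointwise_topology[OF H])
  note I = Iso_mem[OF subsetD[OF H subsetD[OF VH]]]
  \<comment> \<open>The points of \<open>V a\<close> lie in the \<open>r/2\<close>-balls around the points of \<open>A\<close>.  These balls are
    disjoint, so that the connected set \<open>V a\<close> stays in the ball around \<open>a\<close>.\<close>
  have small: "mdist U a (w a) < r / 2" if a: "a \<in> A" and w: "w \<in> V" for a w
  proof (rule ccontr)
    assume nw: "\<not> mdist U a (w a) < r / 2"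
    \<comment> \<open>The separation takes place in the group: \<open>P b\<close> collects the
      elements that send \<open>a\<close> into the ball around \<open>b\<close>. With
      \<open>Q\<close> the union of the \<open>P b\<close> for the other points \<open>b\<close>,
      the identity would lie in \<open>P a\<close> and \<open>w\<close> in \<open>Q\<close>,
      splitting \<open>V\<close>.\<close>
    define P where "P b = {f \<in> H. mdist U b (f a) < r / 2}" for b
    have P: "openin ?T (P b)" if "b \<in> A" for b
      unfolding P_def by (rule openin_pointwise_topology[OF H AU[OF a] AU[OF that]])
    have cov: "\<exists>b\<in>A. f \<in> P b" if f: "f \<in> V" for f
    proof -
      \<comment> \<open>The distance from \<open>A\<close> vanishes at \<open>a\<close>, so by the
        choice of \<open>V0\<close> it is below r / 2 at \<open>f a\<close>.\<close>
      have "mset_dist U A (f a) < r / 2"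
        using V0(3)[of f a] f V(4) a A mset_dist_zero[of A U a] Y by fastforce
      then obtain b where "b \<in> A" "mdist U (f a) b < r / 2"
        using mset_dist_less[OF \<open>A \<noteq> {}\<close>] by blast
      then show ?thesis using f VH by (auto simp: P_def mdist_commute)
    qed
    have disj: "P a \<inter> P b \<inter> V = {}" if b: "b \<in> A" "b \<noteq> a" for b
    proof -
      have "\<not> (mdist U a (f a) < r / 2 \<and> mdist U b (f a) < r / 2)" if f: "f \<in> V" for f
        using mdist_triangle[OF AU[OF a] I(2)[OF f AU[OF a]] AU[OF b(1)]] sep[OF a b(1)] b(2)
        by (auto simp: mdist_commute[of U "f a" b])
      then show ?thesis by (auto simp: P_def)
    qed
    define Q where "Q = (\<Union>b\<in>A - {a}. P b)"
    have "openin ?T Q" unfolding Q_def using P by blast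
    moreover have "V \<subseteq> P a \<union> Q" using cov by (auto simp: Q_def)
    moreover have "P a \<inter> Q \<inter> V = {}" using disj by (auto simp: Q_def)
    moreover have "P a \<inter> V \<noteq> {}"
    proof -
      have "\<one>\<^bsub>Iso U\<^esub> \<in> P a" using one AU[OF a] r(1) by (simp add: P_def one_Iso mdist_self)
      then show ?thesis using V(3) by blast
    qed
    moreover have "Q \<inter> V \<noteq> {}" using cov[OF w] nw w by (auto simp: Q_def P_def)
    ultimately show False using V(2) P[OF a] unfolding connectedin by blast
  qed
  have "mdist U y (w y) < e" if w: "w \<in> V" and y: "y \<in> Y" for w y
  proof -
    obtain a where a: "a \<in> A" "mdist U y a < r" using near_A[OF y] by blast
    have U: "y \<in> mspace U" "a \<in> mspace U" "w y \<in> mspace U" "w a \<in> mspace U"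
      using y Y AU[OF a(1)] I(2)[OF w] by auto
    have "mdist U y (w y) \<le> mdist U y a + mdist U a (w y)"
      "mdist U a (w y) \<le> mdist U a (w a) + mdist U (w a) (w y)"
      using U by (auto intro: mdist_triangle)
    moreover have "mdist U (w a) (w y) = mdist U y a"
      using I(3)[OF w U(2,1)] by (simp add: mdist_commute)
    ultimately show ?thesis using a(2) small[OF a(1) w] r by linarith
  qed
  then show ?thesis using V(1,3) by blast
qed

theorem corollary5p2:
  fixes m :: "'m rel" and U :: "'a metric" and H :: "('a \<Rightarrow> 'a) set"
  assumes "Card_order m" and "natLeq <o m"
    and "is_card_sup {m ^c n | n :: 'm rel. Card_order n \<and> n <o m} m"
    and "Urysohn_Katetov m U"
    and "subgroup H (Iso U)"
    and "top_density (pointwise_topology U H) <o m"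
    and "property_OB (Iso U\<lparr>carrier := H\<rparr>) (pointwise_topology U H)"
    and "metrizable_space (pointwise_topology U H) \<or> locally_connected_space (pointwise_topology U H)"
  shows "SIN_group (Iso U\<lparr>carrier := H\<rparr>) (pointwise_topology U H)"
proof (rule SIN_group_pointwise_topology[OF assms(5)])
  fix x and e :: real assume x: "x \<in> mspace U" and e: "0 < e"
  have H: "H \<subseteq> carrier (Iso U)" and one: "\<one>\<^bsub>Iso U\<^esub> \<in> H"
    using subgroup.subset[OF assms(5)] subgroup.one_closed[OF assms(5)] .
  have orbit: "(\<lambda>g. g x) ` H \<subseteq> mspace U" using Iso_mem(2)[OF subsetD[OF H] x] by blast
  note equi = mset_dist_orbit_equicontinuous[OF assms(1-7) x]
  show "\<exists>V. openin (pointwise_topology U H) V \<and> \<one>\<^bsub>Iso U\<^esub> \<in> V \<and>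
      (\<forall>w\<in>V. \<forall>y\<in>(\<lambda>g. g x) ` H. mdist U y (w y) < e)"
    using assms(8)
  proof
    assume "metrizable_space (pointwise_topology U H)"
    with equi show ?thesis using e by (rule uniformly_small_metrizable[OF H one orbit])
  next
    assume "locally_connected_space (pointwise_topology U H)"
    with equi show ?thesis using e by (rule uniformly_small_locally_connected[OF H one orbit])
  qed
qed

end
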